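(* Let $\mathcal{K}(p_q,p_r)=\mathcal{K}(\|p_q-p_r\|)$ be a shift-invariant kernel which is non-negative and monotonically decreasing in the distance, and suppose there is a bandwidth $h$ such that $\mathcal{K}(d)$ is concave for $d\in[0,h]$ and convex for $d\in[h,\infty)$ (so that $|\mathcal{K}'(d)|$ is maximized at $d=h$). Let $S_r$ be a reference set of size $N$ with expansion constant $c_r$ and let $S_q$ be a query set of size $O(N)$, with cover trees $\mathscr{T}_r$ and $\mathscr{T}_q$ built on them. Using the standard cover tree pruning dual-tree traversal with the absolute-value approximate kernel density estimation functions BaseCase and Score with error parameter $\epsilon$ (all described in the context), the running time of approximate kernel density estimation is bounded by $$O\left(c_r^{8+\lceil\log_2\zeta\rceil}\,\bigl(N+i_t(\mathscr{T}_q)+\theta\bigr)\right),\qquad \zeta=-\mathcal{K}'(h)\,\mathcal{K}^{-1}(\epsilon)\,\epsilon^{-1},$$ where $i_t(\mathscr{T}_q)$ is the cover tree imbalance of the query tree and $\theta = \max\{\min[O(N\log_2(\delta_q/\delta_r)), O(N^2)],\, 0\}$, with $\delta_q$ and $\delta_r$ the smallest nonzero pairwise distances in $S_q$ and $S_r$ respectively.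
   Context: All data sets are finite subsets of a space with metric $d(x,y)=\|x-y\|$. Running times do not include the construction of the trees. $\mathcal{K}^{-1}(\epsilon)$ denotes the distance at which the kernel takes the value $\epsilon$. **Expansion constant.** For $p\in S$ let $B_S(p,\Delta)=\{r\in S: d(p,r)\le\Delta\}$. The expansion constant of $S$ is the smallest $c\ge 2$ such that $|B_S(p,2\Delta)|\le c\,|B_S(p,\Delta)|$ for all $p\in S$ and all $\Delta>0$. **Cover tree.** A cover tree on $S$ is a leveled tree whose levels are indexed by integer scales $s$ that decrease as the tree is descended. Every node is associated with a point of $S$, and a point appears at most once in every level. With $C_s$ the set of points associated with nodes at level $s$, for all $s$: (Nesting) $C_s\subset C_{s-1}$; (Covering) for every $p\in C_{s-1}$ there is $p'\in C_s$ with $d(p,p')<2^{s}$ such that the node of $p'$ at level $s$ is the parent of the node of $p$ at level $s-1$; (Separation) $d(p,p')>2^s$ for all distinct $p,p'\in C_s$. Conceptually (implicit representation) the tree has infinitely many levels, $C_\infty$ consisting of the root point only and $C_{-\infty}=S$. Throughout, the explicit representation is used: every node whose only child is its self-child (the child associated with the same point) is coalesced with it (the self-child is removed and its children become the children of the node). Leaves have scale $-\infty$, and $2^{-\infty}=0$. For a node $\mathscr{N}_i$, $p_i$ is its point, $s_i$ its scale, $\mathscr{C}(\mathscr{N}_i)$ its set of children, $\mathscr{D}^p(\mathscr{N}_i)$ the set of points contained in $\mathscr{N}_i$ and its descendant nodes; every descendant point of $\mathscr{N}_i$ is within distance $2^{s_i+1}$ of $p_i$. The smallest scale of a non-leaf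 node in a cover tree on $S$ is $\lceil\log_2\delta\rceil$, where $\delta$ is the smallest nonzero pairwise distance in $S$. **Imbalance.** For a node $\mathscr{N}_i$ of a cover tree $\mathscr{T}$ with parent of scale $s_p$, and $s_{\min}$ the smallest scale of a non-leaf node of $\mathscr{T}$, the node imbalance $i_n(\mathscr{N}_i)$ is $0$ if $\mathscr{N}_i$ is the root, $\max(s_p-s_{\min}-1,0)$ if $\mathscr{N}_i$ is a leaf, and $s_p-s_i-1$ otherwise. The cover tree imbalance is $i_t(\mathscr{T})=\sum_{\mathscr{N}_i\in\mathscr{T}} i_n(\mathscr{N}_i)$. **Standard pruning dual-tree traversal.** A problem is specified by a point-to-point function BaseCase$(p_q,p_r)$ and a node-to-node function Score$(\mathscr{N}_q,\mathscr{N}_r)$, which returns $\infty$ exactly when the node pair is to be pruned. The recursive traversal takes a query node $\mathscr{N}_q$ and a set $R$ of reference nodes, and is first called with the root of $\mathscr{T}_q$ and $R=\{\text{root of }\mathscr{T}_r\}$. In a call $(\mathscr{N}_q,R)$, put $s_r^{\max}=\max_{\mathscr{N}_r\in R}s_r$. - If $s_q<s_r^{\max}$ (reference recursion): call BaseCase$(p_q,p_r)$ for every $\mathscr{N}_r\in R$; let $R_r=\{\mathscr{N}_r\in R: s_r=s_r^{\max}\}$; let $R_{r-1}$ be the set of all children of nodes of $R_r$ together with $R\setminus R_r$; let $R'_{r-1}=\{\mathscr{N}_r\in R_{r-1}:\text{Score}(\mathscr{N}_q,\mathscr{N}_r)\ne\infty\}$; recurse with $(\mathscr{N}_q,R'_{r-1})$.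 - Otherwise (query recursion): for every child $\mathscr{N}_{qc}$ of $\mathscr{N}_q$, let $R'=\{\mathscr{N}_r\in R:\text{Score}(\mathscr{N}_{qc},\mathscr{N}_r)\ne\infty\}$ and recurse with $(\mathscr{N}_{qc},R')$. **Absolute-value approximate kernel density estimation.** The true kernel density estimate of $p_q\in S_q$ is $f^*(p_q)=\sum_{p_r\in S_r}\mathcal{K}(p_q,p_r)$. The algorithm keeps partial estimates $f_p(p_q)$ for query points and $f_n(\mathscr{N}_q)$ for query nodes, all initialized to $0$. Let $d_{\min}(\mathscr{N}_q,\mathscr{N}_r)=\max(0,\,d(p_q,p_r)-2^{s_q+1}-2^{s_r+1})$ and $d_{\max}(\mathscr{N}_q,\mathscr{N}_r)=d(p_q,p_r)+2^{s_q+1}+2^{s_r+1}$. BaseCase$(p_q,p_r)$: set $f_p(p_q)\gets f_p(p_q)+\mathcal{K}(p_q,p_r)$ and return $\mathcal{K}(p_q,p_r)$. Score$(\mathscr{N}_q,\mathscr{N}_r)$: if $\mathcal{K}(d_{\min}(\mathscr{N}_q,\mathscr{N}_r))-\mathcal{K}(d_{\max}(\mathscr{N}_q,\mathscr{N}_r))<\epsilon$, set $f_n(\mathscr{N}_q)\gets f_n(\mathscr{N}_q)+|\mathscr{D}^p(\mathscr{N}_r)|\bigl(\mathcal{K}(d_{\min}(\mathscr{N}_q,\mathscr{N}_r))+\mathcal{K}(d_{\max}(\mathscr{N}_q,\mathscr{N}_r))\bigr)/2$ and return $\infty$; otherwise return $\mathcal{K}(d_{\min}(\mathscr{N}_q,\mathscr{N}_r))-\mathcal{K}(d_{\max}(\mathscr{N}_q,\mathscr{N}_r))$.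 After the traversal, the estimates $f(p_q)=f_p(p_q)+\sum_{\mathscr{N}_i} f_n(\mathscr{N}_i)$, summed over the nodes $\mathscr{N}_i$ of $\mathscr{T}_q$ having $p_q$ as a descendant, are extracted by one traversal of the query tree.
   Formalization: In the exponent, ⌈log₂ζ⌉ is replaced by max(⌈log₂ζ⌉, 0), so for ζ ≤ 1/2 the bound has c_r^8; the uncut formula fails as ζ → 0. K^{-1}(ε) is assumed to exist uniquely. *)

theory Defs
  imports "HOL-Analysis.Analysis"
begin

section \<open>Expansion constant\<close>

definition ball_in :: "'a::metric_space set \<Rightarrow> 'a \<Rightarrow> real \<Rightarrow> 'a set" where
  "ball_in S p \<Delta> = {r \<in> S. dist p r \<le> \<Delta>}"

definition expansion_constant :: "'a::metric_space set \<Rightarrow> real" where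
  "expansion_constant S =
     (LEAST c. 2 \<le> c \<and>
        (\<forall>p\<in>S. \<forall>\<Delta>>0. real (card (ball_in S p (2 * \<Delta>))) \<le> c * real (card (ball_in S p \<Delta>))))"


section \<open>Cover trees\<close>

text \<open>Trees in explicit representation. A leaf has scale \<open>-\<infinity>\<close>; an inner node carries its
  integer scale. In a cover tree the subtrees hanging below two different nodes are different,
  so a node is identified with the subtree it spans.\<close>

datatype 'a ctree =
    Leaf (point: 'a)
  | Node (point: 'a) (level: int) (children: "'a ctree list")
where
  "children (Leaf p) = []"

fun node_scale :: "'a ctree \<Rightarrow> ereal" where
  "node_scale (Leaf p) = -\<infinity>"
| "node_scale (Node p s cs) = ereal (of_int s)"

text \<open>\<open>reach N\<close> is $2^{s+1}$ for the scale \<open>s\<close> of \<open>N\<close>, where $2^{-\infty} = 0$.\<close>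

fun reach :: "'a ctree \<Rightarrow> real" where
  "reach (Leaf p) = 0"
| "reach (Node p s cs) = 2 powi (s + 1)"

primrec nodes :: "'a ctree \<Rightarrow> 'a ctree list" where
  "nodes (Leaf p) = [Leaf p]"
| "nodes (Node p s cs) = Node p s cs # concat (map nodes cs)"

definition desc_points :: "'a ctree \<Rightarrow> 'a set" where
  "desc_points N = point ` set (nodes N)"

text \<open>The implicit representation: \<open>C s\<close> is the set of points at level \<open>s\<close>, and
  \<open>par s p\<close>, for \<open>p \<in> C s\<close>, is the point of the parent (at level \<open>s + 1\<close>) of the node of
  \<open>p\<close> at level \<open>s\<close>. Since the levels are decreasing in \<open>s\<close>, the intersection and the union of
  all levels are the levels at \<open>\<infinity>\<close> and at \<open>-\<infinity>\<close>. Separation and covering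
  force \<open>par s p = p\<close> whenever \<open>p\<close> also occurs at level \<open>s + 1\<close>, so self-children need
  no separate axiom.\<close>

definition implicit_cover_tree ::
  "'a::metric_space set \<Rightarrow> 'a \<Rightarrow> (int \<Rightarrow> 'a set) \<Rightarrow> (int \<Rightarrow> 'a \<Rightarrow> 'a) \<Rightarrow> bool" where
  "implicit_cover_tree S r C par \<longleftrightarrow>
     (\<Inter>s. C s) = {r} \<and> (\<Union>s. C s) = S \<and>
     (\<forall>s. C s \<subseteq> C (s - 1)) \<and>
     (\<forall>s. \<forall>p\<in>C (s - 1). par (s - 1) p \<in> C s \<and> dist p (par (s - 1) p) < 2 powi s) \<and>
     (\<forall>s. \<forall>p\<in>C s. \<forall>p'\<in>C s. p \<noteq> p' \<longrightarrow> dist p p' > 2 powi s)"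

definition kids :: "(int \<Rightarrow> 'a set) \<Rightarrow> (int \<Rightarrow> 'a \<Rightarrow> 'a) \<Rightarrow> int \<Rightarrow> 'a \<Rightarrow> 'a set" where
  "kids C par s p = {q \<in> C (s - 1). par (s - 1) q = p}"

text \<open>\<open>coalesced C par s p T\<close>: the tree \<open>T\<close> is the explicit representation of the part of the
  implicit tree below the node of \<open>p\<close> at level \<open>s\<close>. A maximal chain of nodes whose only child is the
  self-child is merged with the node at its lower end, whose scale is kept; an infinite chain
  becomes a leaf.\<close>

inductive coalesced ::
  "(int \<Rightarrow> 'a set) \<Rightarrow> (int \<Rightarrow> 'a \<Rightarrow> 'a) \<Rightarrow> int \<Rightarrow> 'a \<Rightarrow> 'a ctree \<Rightarrow> bool"
  for C :: "int \<Rightarrow> 'a set" and par :: "int \<Rightarrow> 'a \<Rightarrow> 'a" where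
  coalesced_leaf:
    "(\<And>t. t \<le> s \<Longrightarrow> kids C par t p = {p}) \<Longrightarrow> coalesced C par s p (Leaf p)"
| coalesced_node:
    "k \<le> s \<Longrightarrow> (\<And>t. k < t \<Longrightarrow> t \<le> s \<Longrightarrow> kids C par t p = {p}) \<Longrightarrow> kids C par k p \<noteq> {p} \<Longrightarrow>
     distinct (map point cs) \<Longrightarrow> set (map point cs) = kids C par k p \<Longrightarrow>
     (\<And>c. c \<in> set cs \<Longrightarrow> coalesced C par (k - 1) (point c) c) \<Longrightarrow>
     coalesced C par s p (Node p k cs)"

definition cover_tree :: "'a::metric_space set \<Rightarrow> 'a ctree \<Rightarrow> bool" where
  "cover_tree S T \<longleftrightarrow>
     finite S \<and>
     (\<exists>r C par s. implicit_cover_tree S r C par \<and> C s = {r} \<and> coalesced C par s r T)"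


section \<open>Imbalance\<close>

definition min_scale :: "'a ctree \<Rightarrow> int" where
  "min_scale T = Min {s. \<exists>p cs. Node p s cs \<in> set (nodes T)}"

text \<open>Imbalance of a non-root node, from the smallest scale \<open>smin\<close> and the scale \<open>sp\<close> of
  the parent.\<close>

fun node_imbalance :: "int \<Rightarrow> int \<Rightarrow> 'a ctree \<Rightarrow> int" where
  "node_imbalance smin sp (Leaf p) = max (sp - smin - 1) 0"
| "node_imbalance smin sp (Node p s cs) = sp - s - 1"

text \<open>The root contributes 0; every other node is counted as a child of its parent.\<close>

definition tree_imbalance :: "'a ctree \<Rightarrow> int" where
  "tree_imbalance T =
     (\<Sum>P\<leftarrow>nodes T. \<Sum>N\<leftarrow>children P. node_imbalance (min_scale T) (level P) N)"


section \<open>The standard pruning dual-tree traversal\<close>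

text \<open>BaseCase and Score may read and update a state; Score returns \<open>\<infinity>\<close> to prune.\<close>

type_synonym ('a, 'st) base_fun = "'a \<Rightarrow> 'a \<Rightarrow> 'st \<Rightarrow> real \<times> 'st"
type_synonym ('a, 'st) score_fun = "'a ctree \<Rightarrow> 'a ctree \<Rightarrow> 'st \<Rightarrow> ereal \<times> 'st"

fun unpruned ::
  "('a, 'st) score_fun \<Rightarrow> 'a ctree \<Rightarrow> 'a ctree list \<Rightarrow> 'st \<Rightarrow> 'a ctree list \<times> 'st" where
  "unpruned score Nq [] st = ([], st)"
| "unpruned score Nq (Nr # R) st =
     (let (v, st1) = score Nq Nr st; (R', st2) = unpruned score Nq R st1
      in (if v \<noteq> \<infinity> then Nr # R' else R', st2))"

text \<open>The supremum of the empty set is \<open>-\<infinity>\<close>, so a call with an empty reference set is a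
  query recursion.\<close>

definition max_scale :: "'a ctree list \<Rightarrow> ereal" where
  "max_scale R = (SUP Nr\<in>set R. node_scale Nr)"

definition ref_children :: "'a ctree list \<Rightarrow> 'a ctree list" where
  "ref_children R =
     concat (map children (filter (\<lambda>Nr. node_scale Nr = max_scale R) R)) @
     filter (\<lambda>Nr. node_scale Nr \<noteq> max_scale R) R"

definition weight :: "'a ctree list \<Rightarrow> nat" where
  "weight R = (\<Sum>Nr\<leftarrow>R. length (nodes Nr))"

lemma weight_simps [simp]:
  "weight [] = 0"
  "weight (N # R) = length (nodes N) + weight R"
  "weight (R @ R') = weight R + weight R'"
  by (simp_all add: weight_def)

lemma length_nodes: "length (nodes N) = Suc (weight (children N))"
  by (cases N) (simp_all add: weight_def length_concat comp_def)

lemma length_nodes_child: "Nc \<in> set (children N) \<Longrightarrow> length (nodes Nc) < length (nodes N)"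
  using member_le_sum_list[of "length (nodes Nc)" "map (\<lambda>N. length (nodes N)) (children N)"]
  by (simp add: length_nodes[of N] weight_def less_Suc_eq_le)

lemma weight_unpruned: "weight (fst (unpruned score Nq R st)) \<le> weight R"
  by (induction R arbitrary: st) (auto simp: split_beta Let_def intro: le_trans trans_le_add2)

lemma weight_expand:
  "weight (concat (map children (filter P R)) @ filter (\<lambda>N. \<not> P N) R) + length (filter P R) = weight R"
  by (induction R) (auto simp: length_nodes)

lemma max_scale_attained: "R \<noteq> [] \<Longrightarrow> \<exists>Nr\<in>set R. node_scale Nr = max_scale R"
  using Max_in[of "node_scale ` set R"] by (auto simp: max_scale_def Max_Sup)

lemma weight_ref_children:
  assumes "node_scale Nq < max_scale R"
  shows "weight (ref_children R) < weight R"
proof -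
  from assms have "R \<noteq> []" by (auto simp: max_scale_def bot_ereal_def)
  then have "filter (\<lambda>Nr. node_scale Nr = max_scale R) R \<noteq> []"
    using max_scale_attained[of R] by (auto simp: filter_empty_conv)
  then show ?thesis
    using weight_expand[of "\<lambda>Nr. node_scale Nr = max_scale R" R]
    unfolding ref_children_def by (simp flip: length_greater_0_conv)
qed

text \<open>The traversal returns the final state and the number of elementary steps performed. One step
  is charged for each call of the traversal, each element of \<open>R\<close> inspected to find the maximal
  scale, each call of BaseCase and each call of Score.\<close>

function traverse ::
  "('a, 'st) base_fun \<Rightarrow> ('a, 'st) score_fun \<Rightarrow> 'a ctree \<Rightarrow> 'a ctree list \<Rightarrow> 'st \<Rightarrow> 'st \<times> nat" where
  "traverse base score Nq R st =
     (if node_scale Nq < max_scale R then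
        let st1 = fold (\<lambda>Nr st. snd (base (point Nq) (point Nr) st)) R st;
            Rst = unpruned score Nq (ref_children R) st1;
            res = traverse base score Nq (fst Rst) (snd Rst)
        in (fst res, 1 + length R + length R + length (ref_children R) + snd res)
      else
        fold (\<lambda>Nqc (st, n).
            let Rst = unpruned score Nqc R st;
                res = traverse base score Nqc (fst Rst) (snd Rst)
            in (fst res, n + length R + snd res))
          (children Nq) (st, 1 + length R))"
  by pat_completeness auto
termination
proof (relation "Wellfounded.measure (\<lambda>(base, score, Nq, R, st). length (nodes Nq) + weight R)", goal_cases)
  case 1
  show ?case by simp
next
  case (2 base score Nq R st)
  then show ?case
    using le_less_trans[OF weight_unpruned weight_ref_children] by (auto simp: split_beta)
next
  case (3 base score Nq R st)
  then show ?case
    by (auto simp: split_beta intro!: add_less_le_mono length_nodes_child weight_unpruned)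
qed

declare traverse.simps [simp del]


section \<open>Absolute-value approximate kernel density estimation\<close>

definition d_min :: "'a::metric_space ctree \<Rightarrow> 'a ctree \<Rightarrow> real" where
  "d_min Nq Nr = max 0 (dist (point Nq) (point Nr) - reach Nq - reach Nr)"

definition d_max :: "'a::metric_space ctree \<Rightarrow> 'a ctree \<Rightarrow> real" where
  "d_max Nq Nr = dist (point Nq) (point Nr) + reach Nq + reach Nr"

text \<open>The state consists of the partial estimates $f_p$ and $f_n$.\<close>

type_synonym 'a kde_state = "('a \<Rightarrow> real) \<times> ('a ctree \<Rightarrow> real)"

fun kde_base :: "(real \<Rightarrow> real) \<Rightarrow> ('a::metric_space, 'a kde_state) base_fun" where
  "kde_base K pq pr (fp, fn) = (K (dist pq pr), (fp(pq := fp pq + K (dist pq pr)), fn))"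

fun kde_score :: "(real \<Rightarrow> real) \<Rightarrow> real \<Rightarrow> ('a::metric_space, 'a kde_state) score_fun" where
  "kde_score K \<epsilon> Nq Nr (fp, fn) =
     (let a = K (d_min Nq Nr); b = K (d_max Nq Nr) in
      if a - b < \<epsilon>
      then (\<infinity>, (fp, fn(Nq := fn Nq + real (card (desc_points Nr)) * (a + b) / 2)))
      else (ereal (a - b), (fp, fn)))"

text \<open>The estimates and the running time. The final extraction of the estimates visits every
  node of the query tree once.\<close>

definition approx_kde ::
  "(real \<Rightarrow> real) \<Rightarrow> real \<Rightarrow> 'a::metric_space ctree \<Rightarrow> 'a ctree \<Rightarrow> ('a \<Rightarrow> real) \<times> nat" where
  "approx_kde K \<epsilon> Tq Tr =
     (let ((fp, fn), n) =
        traverse (kde_base K) (kde_score K \<epsilon>) Tq [Tr] ((\<lambda>_. 0), (\<lambda>_. 0))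
      in (\<lambda>pq. fp pq + (\<Sum>N | N \<in> set (nodes Tq) \<and> pq \<in> desc_points N. fn N),
          n + length (nodes Tq)))"

definition kde_running_time ::
  "(real \<Rightarrow> real) \<Rightarrow> real \<Rightarrow> 'a::metric_space ctree \<Rightarrow> 'a ctree \<Rightarrow> nat" where
  "kde_running_time K \<epsilon> Tq Tr = snd (approx_kde K \<epsilon> Tq Tr)"


section \<open>The quantities in the bound\<close>

definition kernel_inverse :: "(real \<Rightarrow> real) \<Rightarrow> real \<Rightarrow> real" where
  "kernel_inverse K \<epsilon> = (THE d. 0 \<le> d \<and> K d = \<epsilon>)"

text \<open>\<open>D\<close> is the derivative of the kernel at the bandwidth.\<close>

definition zeta :: "(real \<Rightarrow> real) \<Rightarrow> real \<Rightarrow> real \<Rightarrow> real" where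
  "zeta K D \<epsilon> = - D * kernel_inverse K \<epsilon> / \<epsilon>"

definition min_dist :: "'a::metric_space set \<Rightarrow> real" where
  "min_dist S = Min {dist x y | x y. x \<in> S \<and> y \<in> S \<and> x \<noteq> y}"

text \<open>A set with fewer than two points has no smallest nonzero distance; the term is then 0.\<close>

definition theta :: "'a::metric_space set \<Rightarrow> 'a set \<Rightarrow> real" where
  "theta Sq Sr =
     (if card Sq < 2 \<or> card Sr < 2 then 0
      else max (min (real (card Sr) * log 2 (min_dist Sq / min_dist Sr)) ((real (card Sr))\<^sup>2)) 0)"

end

theory Submission
  imports Defs
begin

text \<open>An unpruned pair has a kernel gap of at least \<open>\<epsilon>\<close>. Since the slope of the kernel is nowhere below
  its value at the bandwidth, the distance of the two points is at most \<open>2\<zeta> + 1\<close> times the sum of the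
  two reaches. The reference nodes of a call represent nodes of one level of the implicit reference
  tree, so they and their children are separated at the scale of these reaches, and a packing argument
  bounds their number by a power of the expansion constant. It remains to count calls: every query
  node has one query recursion, and the scales of its reference recursions strictly decrease between
  the scale of its parent and its own; the imbalance of the tree bounds their number, except
  that at a leaf the recursion continues down to the smallest reference scale, which is paid for
  by \<open>\<theta>\<close>.\<close>

section \<open>Packing\<close>

text \<open>The \<open>LEAST\<close> in the definition ranges over reals, so it must be shown to be
  attained: the admissible constants form a closed set bounded below, which contains its infimum
  once it is nonempty.\<close>

lemma
  fixes S :: "'a::metric_space set"
  assumes "finite S"
  shows expansion_constant_ge_2: "2 \<le> expansion_constant S"
    and card_ball_double: "\<lbrakk>p \<in> S; 0 < \<Delta>\<rbrakk> \<Longrightarrow>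
      real (card (ball_in S p (2 * \<Delta>))) \<le> expansion_constant S * real (card (ball_in S p \<Delta>))"
proof -
  define X where "X = {c::real. 2 \<le> c \<and>
    (\<forall>p\<in>S. \<forall>\<Delta>>0. real (card (ball_in S p (2 * \<Delta>))) \<le> c * real (card (ball_in S p \<Delta>)))}"
  have "X = {2..} \<inter> (\<Inter>p\<in>S. \<Inter>\<Delta>\<in>{0<..}.
      {c. real (card (ball_in S p (2 * \<Delta>))) \<le> c * real (card (ball_in S p \<Delta>))})"
    by (auto simp: X_def)
  then have "closed X"
    by (auto intro!: closed_INT closed_Int closed_Collect_le continuous_intros)
  \<comment> \<open>Nonemptiness: a ball around a point of \<open>S\<close> contains its centre, and
    no ball has more than \<open>card S\<close> points.\<close>
  moreover have "max 2 (real (card S)) \<in> X"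
  proof -
    have "real (card (ball_in S p (2 * \<Delta>))) \<le> max 2 (real (card S)) * real (card (ball_in S p \<Delta>))"
      if "p \<in> S" "0 < \<Delta>" for p \<Delta>
    proof -
      have "card (ball_in S p (2 * \<Delta>)) \<le> card S"
        using assms by (intro card_mono) (auto simp: ball_in_def)
      moreover have "card (ball_in S p \<Delta>) \<noteq> 0"
        using assms that by (auto simp: ball_in_def)
      then have "1 \<le> real (card (ball_in S p \<Delta>))" by linarith
      ultimately show ?thesis
        using mult_mono[of "real (card S)" "max 2 (real (card S))" 1 "real (card (ball_in S p \<Delta>))"]
        by (simp add: le_max_iff_disj)
    qed
    then show ?thesis by (auto simp: X_def)
  qed
  moreover have bdd: "bdd_below X" by (auto simp: X_def intro: bdd_belowI[of _ 2])
  ultimately have Inf: "Inf X \<in> X" by (intro closed_contains_Inf) auto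
  have "expansion_constant S = (LEAST c. c \<in> X)"
    by (simp add: expansion_constant_def X_def)
  also have "\<dots> = Inf X"
    using Inf bdd by (intro Least_equality) (auto intro: cInf_lower)
  finally have *: "expansion_constant S \<in> X" using Inf by simp
  then show "2 \<le> expansion_constant S" by (simp add: X_def)
  show "real (card (ball_in S p (2 * \<Delta>))) \<le> expansion_constant S * real (card (ball_in S p \<Delta>))"
    if "p \<in> S" "0 < \<Delta>"
    using * that by (simp add: X_def)
qed

lemma card_ball_power:
  fixes S :: "'a::metric_space set"
  assumes "finite S" "p \<in> S" "0 < \<Delta>"
  shows "real (card (ball_in S p (2 ^ k * \<Delta>)))
    \<le> expansion_constant S ^ k * real (card (ball_in S p \<Delta>))"
proof (induction k)
  case (Suc k)
  have "real (card (ball_in S p (2 ^ Suc k * \<Delta>)))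
      \<le> expansion_constant S * real (card (ball_in S p (2 ^ k * \<Delta>)))"
    using card_ball_double[OF assms(1,2), of "2 ^ k * \<Delta>"] assms(3) by (simp add: mult.assoc)
  also have "\<dots> \<le> expansion_constant S * (expansion_constant S ^ k * real (card (ball_in S p \<Delta>)))"
    using Suc expansion_constant_ge_2[OF assms(1)] by (intro mult_left_mono) auto
  finally show ?case by (simp add: mult.assoc)
qed simp

text \<open>The \<open>\<rho>\<close>-balls around \<open>X\<close> are disjoint, and their union
  lies in the \<open>2 ^ k * \<rho>\<close>-ball around each point of \<open>X\<close>. Comparing
  the union with each of these balls and summing lets its size cancel.\<close>

lemma card_separated_le:
  fixes S :: "'a::metric_space set"
  assumes "finite S" "X \<subseteq> S" "0 < \<rho>"
    and sep: "\<And>x y. \<lbrakk>x \<in> X; y \<in> X; x \<noteq> y\<rbrakk> \<Longrightarrow> 2 * \<rho> < dist x y"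
    and diam: "\<And>x y. \<lbrakk>x \<in> X; y \<in> X\<rbrakk> \<Longrightarrow> dist x y \<le> D"
    and k: "D + \<rho> \<le> 2 ^ k * \<rho>"
  shows "real (card X) \<le> expansion_constant S ^ k"
proof (cases "X = {}")
  case False
  define U where "U = (\<Union>x\<in>X. ball_in S x \<rho>)"
  have fin: "finite X" "finite U" "\<And>x \<rho>. finite (ball_in S x \<rho>)"
    using assms(1,2) by (auto simp: U_def ball_in_def intro: finite_subset)
  have "ball_in S x \<rho> \<inter> ball_in S y \<rho> = {}" if "x \<in> X" "y \<in> X" "x \<noteq> y" for x y
  proof (rule equals0I)
    fix z assume "z \<in> ball_in S x \<rho> \<inter> ball_in S y \<rho>"
    then show False
      using sep[OF that] dist_triangle2[of x y z] by (simp add: ball_in_def)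
  qed
  then have card_U: "card U = (\<Sum>x\<in>X. card (ball_in S x \<rho>))"
    unfolding U_def using fin by (intro card_UN_disjoint) auto
  have "real (card U) \<le> expansion_constant S ^ k * real (card (ball_in S x \<rho>))" if "x \<in> X" for x
  proof -
    have "U \<subseteq> ball_in S x (2 ^ k * \<rho>)"
    proof
      fix z assume "z \<in> U"
      then obtain y where "y \<in> X" "z \<in> S" "dist y z \<le> \<rho>" by (auto simp: U_def ball_in_def)
      then show "z \<in> ball_in S x (2 ^ k * \<rho>)"
        using diam[OF that \<open>y \<in> X\<close>] dist_triangle[of x z y] k by (simp add: ball_in_def)
    qed
    then have "card U \<le> card (ball_in S x (2 ^ k * \<rho>))" using fin by (intro card_mono)
    then show ?thesis
      using card_ball_power[OF assms(1) _ assms(3), of x k] that assms(2) by fastforce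
  qed
  then have "(\<Sum>x\<in>X. real (card U)) \<le> (\<Sum>x\<in>X. expansion_constant S ^ k * real (card (ball_in S x \<rho>)))"
    by (rule sum_mono)
  then have "real (card X) * real (card U) \<le> expansion_constant S ^ k * real (card U)"
    by (simp add: card_U sum_distrib_left)
  moreover have "U \<noteq> {}" using False assms(2,3) by (force simp: U_def ball_in_def)
  then have "0 < real (card U)" using fin by (simp add: card_gt_0_iff)
  ultimately show ?thesis by simp
next
  case True
  then show ?thesis using expansion_constant_ge_2[OF assms(1)] by simp
qed


section \<open>Implicit and explicit cover trees\<close>

lemma nodes_self [simp]: "N \<in> set (nodes N)"
  by (cases N) auto

lemma nodes_trans: "N' \<in> set (nodes N) \<Longrightarrow> N'' \<in> set (nodes N') \<Longrightarrow> N'' \<in> set (nodes N)"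
  by (induction N) auto

lemma children_nodes: "N' \<in> set (children N) \<Longrightarrow> N' \<in> set (nodes N)"
  by (cases N) (auto intro!: bexI[of _ N'])

section \<open>Counting the nodes of a tree by its leaves\<close>

primrec leaf_points :: "'a ctree \<Rightarrow> 'a list" where
  "leaf_points (Leaf p) = [p]"
| "leaf_points (Node p s cs) = concat (map leaf_points cs)"

text \<open>The summand 1 strengthens the induction: every child brings a spare unit, and two of
  them pay for the node itself and for its own spare unit.\<close>

lemma length_nodes_leaf_points:
  assumes "\<And>p k cs. Node p k cs \<in> set (nodes N) \<Longrightarrow> 2 \<le> length cs"
  shows "length (nodes N) + 1 \<le> 2 * length (leaf_points N)"
  using assms
proof (induction N)
  case (Node p k cs)
  have "length (nodes c) + 1 \<le> 2 * length (leaf_points c)" if "c \<in> set cs" for c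
  proof (rule Node.IH[OF that])
    show "2 \<le> length cs'" if "Node p' k' cs' \<in> set (nodes c)" for p' k' cs'
      using Node.prems[of p' k' cs'] that \<open>c \<in> set cs\<close> by auto
  qed
  then have "(\<Sum>c\<leftarrow>cs. length (nodes c) + 1) \<le> (\<Sum>c\<leftarrow>cs. 2 * length (leaf_points c))"
    by (rule sum_list_mono)
  moreover have "(\<Sum>c\<leftarrow>cs. length (nodes c) + 1) = (\<Sum>c\<leftarrow>cs. length (nodes c)) + length cs"
    by (induction cs) auto
  moreover have "2 \<le> length cs" using Node.prems by auto
  ultimately show ?case
    by (simp add: length_concat comp_def sum_list_const_mult)
qed simp

section \<open>Levels, parents and descendants in the implicit tree\<close>

locale implicit_tree =
  fixes S :: "'a::metric_space set" and r C par
  assumes implicit: "implicit_cover_tree S r C par"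
begin

lemmas implicit_axioms = implicit[unfolded implicit_cover_tree_def]

lemma nested: "t \<le> s \<Longrightarrow> C s \<subseteq> C t"
proof (induction s rule: int_ge_induct)
  case (step i)
  have "C (i + 1) \<subseteq> C (i + 1 - 1)"
    using implicit_axioms[THEN conjunct2, THEN conjunct2, THEN conjunct1] by (rule spec)
  then show ?case using step by simp
qed simp

lemma subset: "C s \<subseteq> S"
  using implicit_axioms[THEN conjunct2, THEN conjunct1] by auto

lemma par:
  assumes "p \<in> C s"
  shows par_in: "par s p \<in> C (s + 1)" and par_dist: "dist p (par s p) < 2 powi (s + 1)"
proof -
  have "\<forall>p\<in>C (s + 1 - 1). par (s + 1 - 1) p \<in> C (s + 1) \<and> dist p (par (s + 1 - 1) p) < 2 powi (s + 1)"
    using implicit_axioms[THEN conjunct2, THEN conjunct2, THEN conjunct2, THEN conjunct1] by (rule spec)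
  then show "par s p \<in> C (s + 1)" "dist p (par s p) < 2 powi (s + 1)" using assms by simp_all
qed

lemma separated: "\<lbrakk>p \<in> C s; q \<in> C s; p \<noteq> q\<rbrakk> \<Longrightarrow> 2 powi s < dist p q"
  using implicit_axioms[THEN conjunct2, THEN conjunct2, THEN conjunct2, THEN conjunct2] by simp

text \<open>Otherwise \<open>p\<close> and its parent would be distinct points of
  \<open>C (s + 1)\<close>, closer than separation allows.\<close>

lemma par_self:
  assumes "p \<in> C (s + 1)"
  shows "par s p = p"
proof -
  have "p \<in> C s" using assms nested[of s "s + 1"] by auto
  then show ?thesis
    using par_in par_dist separated[OF assms, of "par s p"] by fastforce
qed

lemma self_in_kids: "p \<in> C s \<Longrightarrow> p \<in> kids C par s p"
  using nested[of "s - 1" s] par_self[of p "s - 1"] by (auto simp: kids_def)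

text \<open>An explicit node stands for a whole chain of self-children, of which it records only the
  lower end. The parameter \<open>s\<close> selects one level of that chain, so that nodes of
  different scales can be placed on a common level and its separation applies to them.\<close>

definition represents :: "int \<Rightarrow> 'a ctree \<Rightarrow> bool" where
  "represents s N \<longleftrightarrow> point N \<in> C s \<and> coalesced C par s (point N) N"

lemma represents_Node:
  assumes "represents s (Node p k cs)"
  shows "k \<le> s" "p \<in> C k" "distinct (map point cs)" "point ` set cs = kids C par k p"
    "kids C par k p \<noteq> {p}" "c \<in> set cs \<Longrightarrow> represents (k - 1) c"
proof -
  have "coalesced C par s p (Node p k cs)" using assms by (simp add: represents_def)
  then have *: "k \<le> s \<and> distinct (map point cs) \<and> point ` set cs = kids C par k p \<and>
      kids C par k p \<noteq> {p} \<and> (\<forall>c\<in>set cs. coalesced C par (k - 1) (point c) c)"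
    by (cases rule: coalesced.cases) auto
  then show "k \<le> s" "distinct (map point cs)" "point ` set cs = kids C par k p"
    "kids C par k p \<noteq> {p}" by auto
  show "p \<in> C k" using assms * nested[of k s] by (auto simp: represents_def)
  show "represents (k - 1) c" if "c \<in> set cs"
    using * that by (auto simp: represents_def kids_def)
qed

lemma represents_scale: "represents s N \<Longrightarrow> node_scale N \<le> ereal (of_int s)"
  using represents_Node(1) by (cases N) auto

text \<open>The chain merged into \<open>N\<close> may be entered at any level down to the scale of
  \<open>N\<close>.\<close>

lemma represents_lower:
  assumes "represents s N" "node_scale N \<le> ereal (of_int t)" "t \<le> s"
  shows "represents t N"
proof -
  have "coalesced C par s (point N) N" using assms(1) by (simp add: represents_def)
  then have "coalesced C par t (point N) N"
  proof (cases rule: coalesced.cases)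
    case coalesced_leaf
    then show ?thesis using assms(3) coalesced.coalesced_leaf[of t C par "point N"] by force
  next
    case (coalesced_node k cs)
    then have "k \<le> t" using assms(2) by (metis ereal_less_eq(3) node_scale.simps(2) of_int_le_iff)
    then have "coalesced C par t (point N) (Node (point N) k cs)"
      using coalesced_node assms(3) by (intro coalesced.coalesced_node) auto
    then show ?thesis using coalesced_node(1) by metis
  qed
  then show ?thesis using assms(1,3) nested[of t s] by (auto simp: represents_def)
qed

lemma represents_nodes:
  assumes "represents s N" "N' \<in> set (nodes N)"
  obtains t where "represents t N'"
  using assms
proof (induction N arbitrary: s thesis)
  case (Node p k cs)
  show ?case
  proof (cases "N' = Node p k cs")
    case False
    then obtain c where "c \<in> set cs" "N' \<in> set (nodes c)" using Node.prems(3) by auto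
    then show ?thesis using Node.IH represents_Node(6)[OF Node.prems(2)] Node.prems(1) by blast
  qed (use Node.prems in blast)
qed auto

text \<open>The self-child is always present, and coalescing excludes that it is the only
  child.\<close>

lemma represents_two_children:
  assumes "represents s (Node p k cs)"
  obtains q where "q \<in> kids C par k p" "q \<noteq> p" "2 \<le> length cs"
proof -
  note N = represents_Node[OF assms]
  obtain q where q: "q \<in> kids C par k p" "q \<noteq> p"
    using N(2,5) self_in_kids by blast
  have "{p, q} \<subseteq> point ` set cs" using N(2,4) q(1) self_in_kids by blast
  then have "card {p, q} \<le> card (point ` set cs)" by (intro card_mono) auto
  also have "\<dots> \<le> length cs" by (metis card_length length_map list.set_map)
  finally show ?thesis using that q by auto
qed

text \<open>\<open>desc s q p\<close>: the node of \<open>p\<close> at level \<open>s\<close> is the ancestor of the point \<open>q\<close>.\<close>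

inductive desc :: "int \<Rightarrow> 'a \<Rightarrow> 'a \<Rightarrow> bool" where
  desc_self: "q \<in> C s \<Longrightarrow> desc s q q"
| desc_par: "desc s q p \<Longrightarrow> desc (s + 1) q (par s p)"

lemma desc_in: "desc s q p \<Longrightarrow> p \<in> C s"
  by (induction rule: desc.induct) (auto intro: par_in)

lemma desc_in_S: "desc s q p \<Longrightarrow> q \<in> S"
  by (induction rule: desc.induct) (use subset in auto)

lemma desc_level: "desc s q p \<Longrightarrow> q \<in> C s \<Longrightarrow> p = q"
proof (induction rule: desc.induct)
  case (desc_par s q p)
  then show ?case using nested[of s "s + 1"] par_self by auto
qed simp

lemma desc_unique: "desc s q p \<Longrightarrow> desc s q p' \<Longrightarrow> p = p'"
proof (induction arbitrary: p' rule: desc.induct)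
  case (desc_self q s)
  then show ?case using desc_level by blast
next
  case (desc_par s q p)
  from desc_par.prems show ?case
  proof (cases rule: desc.cases)
    case desc_self
    then show ?thesis using desc.desc_par[OF desc_par.hyps] desc_level by blast
  next
    case (desc_par t p'')
    then show ?thesis using desc_par.IH[of p''] by simp
  qed
qed

lemma desc_iff: "p \<in> C s \<Longrightarrow> desc s q p \<longleftrightarrow> (\<exists>p'\<in>kids C par s p. desc (s - 1) q p')"
proof
  assume p: "p \<in> C s" and "desc s q p"
  from this(2) show "\<exists>p'\<in>kids C par s p. desc (s - 1) q p'"
  proof (cases rule: desc.cases)
    case desc_self
    then show ?thesis using self_in_kids[OF p] by (auto simp: kids_def intro: desc.desc_self)
  next
    case (desc_par t p')
    then show ?thesis using desc_in by (auto simp: kids_def)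
  qed
next
  assume "\<exists>p'\<in>kids C par s p. desc (s - 1) q p'"
  then show "desc s q p" using desc_par[of "s - 1" q] by (auto simp: kids_def)
qed

lemma desc_chain:
  assumes "p \<in> C s" "t \<le> s" "\<And>u. t < u \<Longrightarrow> u \<le> s \<Longrightarrow> kids C par u p = {p}"
  shows "desc s q p \<longleftrightarrow> desc t q p"
  using assms(2,1,3)
proof (induction s rule: int_ge_induct)
  case (step s)
  then have "desc s q p \<longleftrightarrow> desc t q p" using nested[of s "s + 1"] by auto
  then show ?case using step desc_iff[of p "s + 1" q] by simp
qed simp

text \<open>Every node on the endless chain has only its self-child, so no step of the path from
  \<open>q\<close> up to \<open>p\<close> can change the point.\<close>

lemma desc_const:
  assumes "\<And>u. u \<le> s \<Longrightarrow> kids C par u p = {p}" "p \<in> C s" "desc s q p"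
  shows "q = p"
  using assms(3,1,2)
proof (induction rule: desc.induct)
  case (desc_par s q p')
  have "p' \<in> kids C par (s + 1) (par s p')" using desc_in[OF desc_par.hyps] by (simp add: kids_def)
  then have "p' = par s p'" using desc_par.prems(1)[of "s + 1"] by auto
  then show ?case using desc_par.IH desc_par.prems desc_in[OF desc_par.hyps] by force
qed simp

text \<open>Coalescing removes only self-links, which by \<open>desc_chain\<close> leave descendants
  unchanged, and subtrees of distinct children are disjoint because ancestors are unique. Hence the
  size of \<open>S\<close> bounds the number of leaves.\<close>

lemma leaf_points:
  assumes "represents s N"
  shows "distinct (leaf_points N)" "set (leaf_points N) = {q. desc s q (point N)}"
proof -
  have "distinct (leaf_points N) \<and> set (leaf_points N) = {q. desc s q (point N)}"
    using assms
  proof (induction N arbitrary: s)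
    case (Leaf p)
    then have "coalesced C par s p (Leaf p)" and p: "p \<in> C s" by (auto simp: represents_def)
    then have "\<And>u. u \<le> s \<Longrightarrow> kids C par u p = {p}" by (auto elim: coalesced.cases)
    then show ?case using desc_const[OF _ p] desc_self[OF p] by auto
  next
    case (Node p k cs)
    note N = represents_Node[OF Node.prems]
    have IH: "distinct (leaf_points c)" "set (leaf_points c) = {q. desc (k - 1) q (point c)}"
      if "c \<in> set cs" for c
      using Node.IH[OF that N(6)[OF that]] by auto
    have "coalesced C par s p (Node p k cs)" "p \<in> C s"
      using Node.prems by (auto simp: represents_def)
    then have "desc s q p \<longleftrightarrow> desc k q p" for q
      by (intro desc_chain) (auto elim: coalesced.cases)
    then have "desc s q p \<longleftrightarrow> (\<exists>c\<in>set cs. desc (k - 1) q (point c))" for q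
      using desc_iff[OF N(2), of q] by (simp flip: N(4))
    moreover have "distinct (concat (map leaf_points cs))"
      using N(3) IH
    proof (induction cs)
      case (Cons c cs)
      have "set (leaf_points c) \<inter> set (leaf_points c') = {}" if "c' \<in> set cs" for c'
      proof -
        have "point c \<noteq> point c'" using Cons.prems(1) that by auto
        then show ?thesis using Cons.prems(3)[of c] Cons.prems(3)[of c'] that desc_unique by auto
      qed
      then show ?case using Cons by auto
    qed simp
    ultimately show ?case using IH by auto
  qed
  then show "distinct (leaf_points N)" "set (leaf_points N) = {q. desc s q (point N)}" by auto
qed

lemma length_nodes_le:
  assumes "represents s N" "finite S"
  shows "length (nodes N) + 1 \<le> 2 * card S"
proof -
  have "2 \<le> length cs" if "Node p k cs \<in> set (nodes N)" for p k cs
    using represents_nodes[OF assms(1) that] represents_two_children by metis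
  then have "length (nodes N) + 1 \<le> 2 * length (leaf_points N)" by (rule length_nodes_leaf_points)
  moreover have "length (leaf_points N) = card (set (leaf_points N))"
    using leaf_points(1)[OF assms(1)] by (simp add: distinct_card)
  moreover have "\<dots> \<le> card S"
    using leaf_points(2)[OF assms(1)] desc_in_S assms(2) by (intro card_mono) auto
  ultimately show ?thesis by linarith
qed

text \<open>Climbing by \<open>par\<close> from a level that contains \<open>q\<close> leads to
  level \<open>s\<close>, whose only point is the root; a point found above \<open>s\<close> is in
  level \<open>s\<close> by nesting.\<close>

lemma leaf_points_root:
  assumes "represents s N" "C s = {point N}"
  shows "set (leaf_points N) = S"
proof -
  have "desc s q (point N)" if "q \<in> S" for q
  proof -
    obtain t where t: "q \<in> C t"
      using \<open>q \<in> S\<close> implicit_axioms[THEN conjunct2, THEN conjunct1] by auto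
    show ?thesis
    proof (cases "t \<le> s")
      case True
      then have "\<exists>p. desc s q p"
      proof (induction s rule: int_ge_induct)
        case base
        then show ?case using t desc_self by blast
      next
        case (step s)
        then show ?case using desc_par by blast
      qed
      then show ?thesis using desc_in[of s q] assms(2) by auto
    next
      case False
      then have "q \<in> C s" using t nested[of s t] by auto
      then show ?thesis using assms(2) desc_self by auto
    qed
  qed
  then show ?thesis using leaf_points(2)[OF assms(1)] desc_in_S by auto
qed

text \<open>Children of a node of scale \<open>k\<close> represent level \<open>k - 1\<close>,
  whence the shift by one. With \<open>m\<close> the smallest scale, all points of the tree are
  separated at level \<open>m - 1\<close>.\<close>

lemma leaf_points_level:
  assumes "represents s N" "m - 1 \<le> s" "\<And>p k cs. Node p k cs \<in> set (nodes N) \<Longrightarrow> m \<le> k"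
  shows "set (leaf_points N) \<subseteq> C (m - 1)"
  using assms
proof (induction N arbitrary: s)
  case (Leaf p)
  then show ?case using nested[of "m - 1" s] by (auto simp: represents_def)
next
  case (Node p k cs)
  have "set (leaf_points c) \<subseteq> C (m - 1)" if "c \<in> set cs" for c
  proof (rule Node.IH[OF that represents_Node(6)[OF Node.prems(1) that]])
    show "m - 1 \<le> k - 1" using Node.prems(3)[of p k cs] by simp
    show "m \<le> k'" if "Node p' k' cs' \<in> set (nodes c)" for p' k' cs'
      using Node.prems(3)[of p' k' cs'] that \<open>c \<in> set cs\<close> by auto
  qed
  then show ?case by auto
qed

end

section \<open>The kernel\<close>

text \<open>Slopes of secants starting at \<open>h\<close> increase with the right end, so their
  limit \<open>D\<close> bounds them from below; comparing adjacent secants extends this to secants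
  that start later.\<close>

lemma convex_slope_ge_derivative:
  fixes f :: "real \<Rightarrow> real"
  assumes convex: "convex_on {h..c} f" and deriv: "(f has_real_derivative D) (at h within {h..c})"
    and "h \<le> a" "a \<le> b" "b \<le> c"
  shows "D * (b - a) \<le> f b - f a"
proof -
  have *: "D * (b - h) \<le> f b - f h" if "h < b" "b \<le> c" for b
  proof -
    have "((\<lambda>x. (f x - f h) / (x - h)) \<longlongrightarrow> D) (at h within {h..c})"
      using deriv by (simp add: has_field_derivative_iff)
    then have "((\<lambda>x. (f x - f h) / (x - h)) \<longlongrightarrow> D) (at h within {h..b})"
      by (rule tendsto_within_subset) (use that in auto)
    moreover have "\<forall>\<^sub>F x in at h within {h..b}. (f x - f h) / (x - h) \<le> (f b - f h) / (b - h)"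
      unfolding eventually_at_filter
    proof (intro always_eventually allI impI)
      fix x assume "x \<noteq> h" "x \<in> {h..b}"
      then show "(f x - f h) / (x - h) \<le> (f b - f h) / (b - h)"
        using convex_on_slope_le(1)[OF convex, of h b x] that
          minus_divide_divide[of "f h - f x" "h - x"] minus_divide_divide[of "f h - f b" "h - b"]
        by (cases "x = b") auto
    qed
    moreover have "at h within {h..b} \<noteq> bot"
      using that by (simp add: at_within_Icc_at_right)
    ultimately have "D \<le> (f b - f h) / (b - h)" by (rule tendsto_upperbound)
    then show ?thesis using that by (simp add: field_simps)
  qed
  consider "a = b" | "a = h" "h < b" | "h < a" "a < b" using assms(3,4) by linarith
  then show ?thesis
  proof cases
    case 3
    have "D \<le> (f h - f a) / (h - a)" using *[of a] 3 assms(5) by (simp add: field_simps)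
    also have "\<dots> \<le> (f h - f b) / (h - b)"
      using convex_on_slope_le(1)[OF convex, of h b a] 3 assms(5) by auto
    also have "\<dots> \<le> (f a - f b) / (a - b)"
      using convex_on_slope_le(2)[OF convex, of h b a] 3 assms(5) by auto
    finally show ?thesis using 3 by (simp add: field_simps)
  qed (use *[of b] assms(5) in auto)
qed

lemma concave_slope_ge_derivative:
  fixes f :: "real \<Rightarrow> real"
  assumes concave: "concave_on {c..h} f" and deriv: "(f has_real_derivative D) (at h within {c..h})"
    and "c \<le> a" "a \<le> b" "b \<le> h"
  shows "D * (b - a) \<le> f b - f a"
proof -
  \<comment> \<open>This point reflection turns concavity into convexity and preserves
    slopes.\<close>
  define g where "g x = - f (- x)" for x
  have "convex_on {-h..-c} g"
  proof (rule convex_onI)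
    fix t x y :: real
    assume t: "0 < t" "t < 1" and "x \<in> {-h..-c}" "y \<in> {-h..-c}"
    then have "- x \<in> {c..h}" "- y \<in> {c..h}" by auto
    moreover have "convex_on {c..h} (\<lambda>x. - f x)" using concave by (simp add: concave_on_def)
    ultimately have "- f ((1 - t) *\<^sub>R (- x) + t *\<^sub>R (- y)) \<le> (1 - t) * (- f (- x)) + t * (- f (- y))"
      using t by (intro convex_onD[where f = "\<lambda>x. - f x"]) auto
    then show "g ((1 - t) *\<^sub>R x + t *\<^sub>R y) \<le> (1 - t) * g x + t * g y"
      by (simp add: g_def algebra_simps)
  qed simp
  moreover have "(g has_real_derivative D) (at (- h) within {-h..-c})"
  proof -
    have "(f \<circ> uminus has_real_derivative D * - 1) (at (- h) within {-h..-c})"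
      using deriv by (intro DERIV_image_chain) (auto intro!: derivative_eq_intros)
    then show ?thesis unfolding g_def comp_def by (auto intro!: derivative_eq_intros)
  qed
  ultimately have "D * (- a - - b) \<le> g (- a) - g (- b)"
    using assms(3-5) by (intro convex_slope_ge_derivative[of "- h" "- c"]) auto
  then show ?thesis by (simp add: g_def)
qed

lemma reach_nonneg: "0 \<le> reach N"
  by (cases N) auto

lemma reach_le: "node_scale N \<le> ereal (of_int t) \<Longrightarrow> reach N \<le> 2 * 2 powi t"
proof (cases N)
  case (Node p s cs)
  assume "node_scale N \<le> ereal (of_int t)"
  then have "(2::real) powi (s + 1) \<le> 2 powi (t + 1)"
    using Node by (intro power_int_increasing) auto
  then show ?thesis using Node by (simp add: power_int_add)
qed auto

text \<open>The derivative is taken within \<open>{0..}\<close>, so it is one-sided if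
  \<open>h = 0\<close>. The last assumption makes \<open>kernel_inverse K \<epsilon>\<close> well
  defined although \<open>K\<close> is only weakly decreasing.\<close>

locale kde_kernel =
  fixes K :: "real \<Rightarrow> real" and K' h \<epsilon> :: real
  assumes nonneg: "0 \<le> d \<Longrightarrow> 0 \<le> K d"
    and antimono: "antimono_on {0..} K"
    and h: "0 \<le> h" and concave: "concave_on {0..h} K" and convex: "convex_on {h..} K"
    and deriv: "(K has_real_derivative K') (at h within {0..})"
    and \<epsilon>: "0 < \<epsilon>" and level_unique: "\<exists>!d. 0 \<le> d \<and> K d = \<epsilon>"
begin

abbreviation \<zeta> :: real where "\<zeta> \<equiv> zeta K K' \<epsilon>"

lemma antimonoD: "0 \<le> a \<Longrightarrow> a \<le> b \<Longrightarrow> K b \<le> K a"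
  using antimono by (auto simp: monotone_on_def)

text \<open>This expresses that the kernel is steepest at \<open>h\<close>, by secants because
  \<open>K\<close> may fail to be differentiable elsewhere. An interval around \<open>h\<close> is
  split there.\<close>

lemma slope_ge:
  assumes "0 \<le> a" "a \<le> b"
  shows "K' * (b - a) \<le> K b - K a"
proof -
  have left: "K' * (y - x) \<le> K y - K x" if "0 \<le> x" "x \<le> y" "y \<le> h" for x y
    using that by (intro concave_slope_ge_derivative[OF concave DERIV_subset[OF deriv]]) auto
  have right: "K' * (y - x) \<le> K y - K x" if "h \<le> x" "x \<le> y" for x y
  proof (rule convex_slope_ge_derivative)
    show "convex_on {h..y} K" by (rule convex_on_subset[OF convex]) auto
    show "(K has_real_derivative K') (at h within {h..y})"
      using h by (intro DERIV_subset[OF deriv]) auto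
  qed (use that in auto)
  consider "b \<le> h" | "h \<le> a" | "a < h" "h < b" by linarith
  then show ?thesis
  proof cases
    case 3
    then show ?thesis using left[of a h] right[of h b] assms by (simp add: algebra_simps)
  qed (use left right assms in auto)
qed

lemma kernel_inverse: "0 \<le> kernel_inverse K \<epsilon>" "K (kernel_inverse K \<epsilon>) = \<epsilon>"
  using theI'[OF level_unique] by (auto simp: kernel_inverse_def)

lemma deriv_nonpos: "K' \<le> 0"
  using slope_ge[of h "h + 1"] antimonoD[of h "h + 1"] h by simp

lemma zeta_nonneg: "0 \<le> \<zeta>"
  using deriv_nonpos kernel_inverse(1) \<epsilon>
  unfolding zeta_def by (intro divide_nonneg_pos mult_nonneg_nonneg) auto

definition kept :: "'b::metric_space ctree \<Rightarrow> 'b ctree \<Rightarrow> bool" where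
  "kept Nq Nr \<longleftrightarrow> \<epsilon> \<le> K (d_min Nq Nr) - K (d_max Nq Nr)"

text \<open>The pruning decision ignores the partial estimates, so the steps can be counted without
  tracking the state.\<close>

lemma unpruned_eq: "fst (unpruned (kde_score K \<epsilon>) Nq R st) = filter (kept Nq) R"
proof (induction R arbitrary: st)
  case (Cons N R)
  then show ?case by (cases st) (auto simp: split_beta Let_def kept_def)
qed simp

text \<open>Nonnegativity gives \<open>K\<close> a value of at least \<open>\<epsilon>\<close> at
  \<open>d_min\<close>, so \<open>d_min\<close> is at most
  \<open>kernel_inverse K \<epsilon>\<close>. The slope bound gives \<open>\<epsilon>\<close> at
  most \<open>- K'\<close> times twice the sum of the reaches; multiplying by
  \<open>kernel_inverse K \<epsilon> / \<epsilon>\<close> brings in \<open>\<zeta>\<close>.\<close>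

lemma kept_dist:
  assumes "kept Nq Nr"
  shows "dist (point Nq) (point Nr) \<le> (2 * \<zeta> + 1) * (reach Nq + reach Nr)"
proof -
  let ?d = "dist (point Nq) (point Nr)" and ?\<rho> = "reach Nq + reach Nr"
  have min0: "0 \<le> d_min Nq Nr" and le: "d_min Nq Nr \<le> d_max Nq Nr"
    and max_min: "d_max Nq Nr - d_min Nq Nr \<le> 2 * ?\<rho>"
    and min_ge: "?d - ?\<rho> \<le> d_min Nq Nr"
    using reach_nonneg[of Nq] reach_nonneg[of Nr] by (auto simp: d_min_def d_max_def)
  have "\<epsilon> \<le> K (d_min Nq Nr)"
    using assms nonneg[of "d_max Nq Nr"] min0 le by (simp add: kept_def)
  \<comment> \<open>\<open>K\<close> may have flat pieces, so monotonicity alone does not suffice: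
    beyond \<open>kernel_inverse K \<epsilon>\<close> the value would equal
    \<open>\<epsilon>\<close>, against uniqueness.\<close>
  then have min_le: "d_min Nq Nr \<le> kernel_inverse K \<epsilon>"
    using antimonoD[of "kernel_inverse K \<epsilon>" "d_min Nq Nr"] kernel_inverse level_unique min0
    by (metis dual_order.antisym linorder_linear)
  have "\<epsilon> \<le> - K' * (d_max Nq Nr - d_min Nq Nr)"
    using assms slope_ge[OF min0 le] by (simp add: kept_def)
  also have "\<dots> \<le> - K' * (2 * ?\<rho>)"
    using max_min deriv_nonpos by (intro mult_left_mono) auto
  finally have "kernel_inverse K \<epsilon> * \<epsilon> \<le> kernel_inverse K \<epsilon> * (- K' * (2 * ?\<rho>))"
    using kernel_inverse(1) by (rule mult_left_mono)
  then have "kernel_inverse K \<epsilon> \<le> 2 * \<zeta> * ?\<rho>"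
    using \<epsilon> by (simp add: zeta_def field_simps)
  then show ?thesis using min_ge min_le by (simp add: algebra_simps)
qed

text \<open>The left side is the diameter plus the radius in \<open>length_le_B\<close>, measured in
  packing radii. Since 64 + 41 is at most 256, the exponent 8 suffices; for \<open>\<zeta>\<close>
  at most 1 the other power only has to be at least 1.\<close>

lemma zeta_le_power: "64 * \<zeta> + 41 \<le> 2 ^ (8 + nat \<lceil>log 2 \<zeta>\<rceil>)"
proof -
  let ?n = "nat \<lceil>log 2 \<zeta>\<rceil>"
  have "\<zeta> \<le> 2 ^ ?n"
  proof (cases "\<zeta> \<le> 1")
    case True
    also have "(1::real) \<le> 2 ^ ?n" by simp
    finally show ?thesis .
  next
    case False
    then have "\<zeta> = 2 powr log 2 \<zeta>" by simp
    also have "\<dots> \<le> 2 powr real ?n"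
      by (intro powr_mono) linarith+
    finally show ?thesis by (simp add: powr_realpow)
  qed
  moreover have "(1::real) \<le> 2 ^ ?n" by simp
  moreover have "(2::real) ^ (8 + ?n) = 256 * 2 ^ ?n" by (simp add: power_add)
  ultimately show ?thesis by linarith
qed

end

section \<open>The traversal\<close>

text \<open>Reference recursions at a query node \<open>N\<close> take place at reference scales above
  \<open>bottom_scale smin N\<close>, where \<open>smin\<close> is the smallest scale of the reference tree.\<close>

fun bottom_scale :: "int \<Rightarrow> 'a ctree \<Rightarrow> int" where
  "bottom_scale smin (Leaf p) = smin - 1"
| "bottom_scale smin (Node p s cs) = s"

text \<open>Each summand bounds the reference recursions at one query node: their scales strictly
  decrease, and each lowers the weight of the reference set, whence the cap \<open>W\<close>. The
  cap later yields the quadratic alternative in \<open>theta\<close>.\<close>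

definition scale_gaps :: "int \<Rightarrow> nat \<Rightarrow> 'a ctree \<Rightarrow> nat" where
  "scale_gaps smin W N =
     (\<Sum>P\<leftarrow>nodes N. \<Sum>N'\<leftarrow>children P. min (nat (level P - bottom_scale smin N')) W)"

lemma scale_gaps_Node:
  "scale_gaps smin W (Node p k cs) =
     (\<Sum>c\<leftarrow>cs. min (nat (k - bottom_scale smin c)) W + scale_gaps smin W c)"
proof -
  have "sum_list (map f (concat (map nodes cs))) = (\<Sum>c\<leftarrow>cs. sum_list (map f (nodes c)))"
    for f :: "'a ctree \<Rightarrow> nat"
    by (induction cs) auto
  then show ?thesis by (simp add: scale_gaps_def sum_list_addf)
qed

lemma fold_steps_le:
  assumes "\<And>c st. c \<in> set cs \<Longrightarrow> real (l + snd (g c st)) \<le> u c"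
  shows "real (snd (fold (\<lambda>c (st, n). (fst (g c st), n + l + snd (g c st))) cs (st, n)))
    \<le> real n + (\<Sum>c\<leftarrow>cs. u c)"
  using assms
proof (induction cs arbitrary: st n)
  case (Cons c cs)
  have "real (snd (fold (\<lambda>c (st, n). (fst (g c st), n + l + snd (g c st))) cs
        (fst (g c st), n + l + snd (g c st))))
      \<le> real (n + l + snd (g c st)) + (\<Sum>c\<leftarrow>cs. u c)"
    using Cons.prems by (intro Cons.IH) auto
  moreover have "real (l + snd (g c st)) \<le> u c" using Cons.prems by simp
  ultimately show ?case by simp
qed simp

lemma max_scale_ge: "N \<in> set R \<Longrightarrow> node_scale N \<le> max_scale R"
  by (auto simp: max_scale_def intro: SUP_upper)

lemma less_max_scaleE:
  assumes "x < max_scale R"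
  obtains p s cs where "Node p s cs \<in> set R" "max_scale R = ereal (of_int s)"
proof -
  have "R \<noteq> []" using assms by (auto simp: max_scale_def bot_ereal_def)
  then obtain N where N: "N \<in> set R" "node_scale N = max_scale R"
    using max_scale_attained by blast
  show ?thesis
  proof (cases N)
    case (Leaf p)
    then show ?thesis using assms N(2)[symmetric] by simp
  next
    case (Node p s cs)
    then show ?thesis using that[of p s cs] N by simp
  qed
qed

section \<open>Reference recursion on the levels of the implicit tree\<close>

context implicit_tree
begin

text \<open>An elementwise form of \<open>ref_children\<close>, equal to it up to order, which
  permits induction over \<open>R\<close>.\<close>

definition expand :: "int \<Rightarrow> 'a ctree \<Rightarrow> 'a ctree list" where
  "expand s N = (if node_scale N = ereal (of_int s) then children N else [N])"

lemma mset_ref_children: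
  "max_scale R = ereal (of_int s) \<Longrightarrow> mset (ref_children R) = mset (concat (map (expand s) R))"
  unfolding ref_children_def
proof -
  assume "max_scale R = ereal (of_int s)"
  moreover have "mset (concat (map children (filter (\<lambda>N. node_scale N = ereal (of_int s)) R)) @
      filter (\<lambda>N. node_scale N \<noteq> ereal (of_int s)) R) = mset (concat (map (expand s) R))" for R
    by (induction R) (auto simp: expand_def)
  ultimately show "mset (concat (map children (filter (\<lambda>N. node_scale N = max_scale R) R)) @
      filter (\<lambda>N. node_scale N \<noteq> max_scale R) R) = mset (concat (map (expand s) R))"
    by simp
qed

text \<open>A node of scale \<open>s\<close> gives way to its children; a node of smaller scale
  stays and now stands for its self-child one level down.\<close>

lemma represents_expand:
  assumes "represents s N"
  shows "distinct (map point (expand s N))" "point ` set (expand s N) \<subseteq> kids C par s (point N)"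
    "N' \<in> set (expand s N) \<Longrightarrow> represents (s - 1) N'"
proof -
  have "distinct (map point (expand s N)) \<and> point ` set (expand s N) \<subseteq> kids C par s (point N) \<and>
    (\<forall>N'\<in>set (expand s N). represents (s - 1) N')"
  proof (cases "node_scale N = ereal (of_int s)")
    case True
    then obtain p cs where N: "N = Node p s cs" by (cases N) auto
    then show ?thesis using represents_Node[of s p s cs] assms by (auto simp: expand_def)
  next
    case False
    have "node_scale N \<le> ereal (of_int (s - 1))"
      using False represents_scale[OF assms] by (cases N) auto
    then have "represents (s - 1) N" using represents_lower[OF assms] by simp
    moreover have "point N \<in> kids C par s (point N)"
      using assms self_in_kids by (simp add: represents_def)
    ultimately show ?thesis using False by (simp add: expand_def)
  qed
  then show "distinct (map point (expand s N))" "point ` set (expand s N) \<subseteq> kids C par s (point N)"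
    "N' \<in> set (expand s N) \<Longrightarrow> represents (s - 1) N'" by auto
qed

lemma
  assumes R: "\<forall>N\<in>set R. represents s N" and "distinct (map point R)"
    and max: "max_scale R = ereal (of_int s)"
  shows represents_ref_children: "N \<in> set (ref_children R) \<Longrightarrow> represents (s - 1) N"
    and distinct_ref_children: "distinct (map point (ref_children R))"
    and ref_children_near: "N \<in> set (ref_children R) \<Longrightarrow> \<exists>P\<in>set R. dist (point N) (point P) < 2 powi s"
proof -
  have set_eq: "set (ref_children R) = set (concat (map (expand s) R))"
    using mset_ref_children[OF max] by (rule mset_eq_setD)
  show "represents (s - 1) N" if "N \<in> set (ref_children R)"
    using that R represents_expand(3) unfolding set_eq by auto
  show "\<exists>P\<in>set R. dist (point N) (point P) < 2 powi s" if N: "N \<in> set (ref_children R)"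
  proof -
    obtain P where P: "P \<in> set R" "point N \<in> kids C par s (point P)"
      using N R represents_expand(2) unfolding set_eq by fastforce
    then show ?thesis using par_dist[of "point N" "s - 1"] by (auto simp: kids_def)
  qed
  have "distinct (map point (concat (map (expand s) R)))"
    using assms(2) R
  proof (induction R)
    case (Cons N R)
    \<comment> \<open>A point has only one parent, so different elements of \<open>R\<close> have no
      child in common.\<close>
    have "point ` set (expand s N) \<inter> point ` set (expand s P) = {}" if "P \<in> set R" for P
    proof -
      have "point N \<noteq> point P" using Cons.prems(1) that by auto
      then have "kids C par s (point N) \<inter> kids C par s (point P) = {}"
        by (auto simp: kids_def)
      then show ?thesis
        using represents_expand(2)[of s N] represents_expand(2)[of s P] Cons.prems(2) that
        by auto
    qed
    then show ?case using Cons represents_expand(1)[of s N] by (auto simp: image_UN)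
  qed simp
  moreover have "mset (map point (ref_children R)) = mset (map point (concat (map (expand s) R)))"
    using mset_ref_children[OF max] by simp
  ultimately show "distinct (map point (ref_children R))"
    using mset_eq_imp_distinct_iff by blast
qed

end

lemma nodes_ref_children:
  assumes "set R \<subseteq> set (nodes T)"
  shows "set (ref_children R) \<subseteq> set (nodes T)"
  using assms nodes_trans children_nodes unfolding ref_children_def by fastforce

section \<open>Sizes of the reference sets and the number of steps\<close>

locale kde_traversal = implicit_tree S r C par + kde_kernel K K' h \<epsilon>
  for S :: "'a::metric_space set" and r C par K K' h \<epsilon> +
  assumes finite_S: "finite S"
begin

definition B :: real where
  "B = expansion_constant S ^ (8 + nat \<lceil>log 2 \<zeta>\<rceil>)"

lemma B_ge_1: "1 \<le> B"
  using expansion_constant_ge_2[OF finite_S] by (auto simp: B_def intro!: one_le_power)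

text \<open>The first disjunct covers the initial call, whose single reference node has not been
  scored.\<close>

definition admissible :: "'a ctree \<Rightarrow> 'a ctree list \<Rightarrow> bool" where
  "admissible Nq R \<longleftrightarrow> length R \<le> 1 \<or> (\<forall>N\<in>set R. kept Nq N)"

lemma admissible_dist:
  assumes "admissible Nq R" "node_scale Nq \<le> ereal (of_int t)"
    and R: "\<forall>N\<in>set R. represents t N" and N: "N \<in> set R" "N' \<in> set R"
  shows "dist (point N) (point N') \<le> (16 * \<zeta> + 8) * 2 powi t"
proof (cases "length R \<le> 1")
  case True
  then have "N = N'" using N by (cases R) auto
  then show ?thesis using zeta_nonneg by simp
next
  case False
  have "dist (point Nq) (point N) \<le> (8 * \<zeta> + 4) * 2 powi t" if "N \<in> set R" for N
  proof -
    have "kept Nq N" using that False assms(1) by (auto simp: admissible_def)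
    then have "dist (point Nq) (point N) \<le> (2 * \<zeta> + 1) * (reach Nq + reach N)"
      by (rule kept_dist)
    \<comment> \<open>Both scales are at most \<open>t\<close>, so each reach is at most
      \<open>2 * 2 powi t\<close>. Going through the query point then doubles the bound.\<close>
    also have "\<dots> \<le> (2 * \<zeta> + 1) * (4 * 2 powi t)"
      using reach_le[OF assms(2)] reach_le[OF represents_scale[OF R[rule_format, OF that]]] zeta_nonneg
      by (intro mult_left_mono) auto
    finally show ?thesis by (simp add: algebra_simps)
  qed
  from this[OF N(1)] this[OF N(2)] show ?thesis
    using dist_triangle3[of "point N" "point N'" "point Nq"] by (simp add: algebra_simps)
qed

text \<open>The diameter is dictated by \<open>length_ref_children_le\<close>: two covering steps
  turn \<open>16 * \<zeta> + 8\<close> into \<open>16 * \<zeta> + 10\<close>, which doubles when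
  measured at the next lower level.\<close>

lemma length_le_B:
  assumes R: "\<forall>N\<in>set R. represents t N" and dist: "distinct (map point R)"
    and diam: "\<And>N N'. \<lbrakk>N \<in> set R; N' \<in> set R\<rbrakk> \<Longrightarrow>
      dist (point N) (point N') \<le> (32 * \<zeta> + 20) * 2 powi t"
  shows "real (length R) \<le> B"
proof -
  have sub: "point ` set R \<subseteq> C t" using R by (auto simp: represents_def)
  have "real (card (point ` set R)) \<le> B" unfolding B_def
  proof (rule card_separated_le[OF finite_S])
    show "point ` set R \<subseteq> S" using sub subset by blast
    show "2 * (2 powi t / 2) < dist x y"
      if "x \<in> point ` set R" "y \<in> point ` set R" "x \<noteq> y" for x y
      using that sub separated[of x t y] by auto
    show "(32 * \<zeta> + 20) * 2 powi t + 2 powi t / 2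
        \<le> 2 ^ (8 + nat \<lceil>log 2 \<zeta>\<rceil>) * (2 powi t / 2)"
      using mult_right_mono[OF zeta_le_power, of "2 powi t / 2"] by (simp add: algebra_simps)
  qed (use diam in auto)
  moreover have "card (point ` set R) = length R"
    using dist distinct_card by fastforce
  ultimately show ?thesis by simp
qed

lemma length_R_le:
  assumes "admissible Nq R" "node_scale Nq \<le> ereal (of_int t)"
    and "\<forall>N\<in>set R. represents t N" "distinct (map point R)"
  shows "real (length R) \<le> B"
proof (rule length_le_B[OF assms(3,4)])
  fix N N' assume "N \<in> set R" "N' \<in> set R"
  then have "dist (point N) (point N') \<le> (16 * \<zeta> + 8) * 2 powi t"
    using admissible_dist assms by blast
  also have "\<dots> \<le> (32 * \<zeta> + 20) * 2 powi t"
    using zeta_nonneg by (intro mult_right_mono) auto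
  finally show "dist (point N) (point N') \<le> (32 * \<zeta> + 20) * 2 powi t" .
qed

lemma length_ref_children_le:
  assumes "admissible Nq R" "node_scale Nq \<le> ereal (of_int t)"
    and R: "\<forall>N\<in>set R. represents t N" "distinct (map point R)"
    and max: "max_scale R = ereal (of_int t)"
  shows "real (length (ref_children R)) \<le> B"
proof (rule length_le_B)
  note props = represents_ref_children[OF R max] distinct_ref_children[OF R max]
    ref_children_near[OF R max]
  show "distinct (map point (ref_children R))" using props(2) .
  show "\<forall>N\<in>set (ref_children R). represents (t - 1) N" using props(1) by blast
  fix N N' assume N: "N \<in> set (ref_children R)" "N' \<in> set (ref_children R)"
  obtain P P' where P: "P \<in> set R" "dist (point N) (point P) < 2 powi t"
    "P' \<in> set R" "dist (point N') (point P') < 2 powi t"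
    using props(3) N by meson
  have "dist (point P) (point P') \<le> (16 * \<zeta> + 8) * 2 powi t"
    using admissible_dist assms(1,2) R(1) P by blast
  then have "dist (point N) (point N') \<le> (16 * \<zeta> + 10) * 2 powi t"
    using P(2,4) dist_triangle[of "point N" "point N'" "point P"]
      dist_triangle2[of "point P" "point N'" "point P'"]
    by (simp add: algebra_simps)
  then show "dist (point N) (point N') \<le> (32 * \<zeta> + 20) * 2 powi (t - 1)"
    by (simp add: power_int_diff algebra_simps)
qed

text \<open>The factor \<open>1 + 3 * B\<close> pays for one reference recursion: the call, two
  passes over \<open>R\<close> and one over \<open>ref_children R\<close>. Every query node gets two
  such units, for its query recursion and for the Score calls made on it by its parent; the top node
  lacks the latter, hence the subtracted 1. \<open>w\<close> bounds the current weight of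
  \<open>R\<close> and is reset to \<open>W\<close> at each child.\<close>

lemma traverse_steps_le:
  fixes st :: "'a kde_state"
  assumes "\<And>P N. \<lbrakk>P \<in> set (nodes Nq); N \<in> set (children P)\<rbrakk> \<Longrightarrow> node_scale N < node_scale P"
    and "set R \<subseteq> set (nodes Tr)" "\<And>p s cs. Node p s cs \<in> set (nodes Tr) \<Longrightarrow> smin \<le> s"
    and "\<forall>N\<in>set R. represents m N" "distinct (map point R)"
    and "admissible Nq R" "node_scale Nq \<le> ereal (of_int m)" "weight R \<le> w" "w \<le> W"
  shows "real (snd (traverse base (kde_score K \<epsilon>) Nq R st))
    \<le> (1 + 3 * B) * (real (min (nat (m - bottom_scale smin Nq)) w + scale_gaps smin W Nq)
        + 2 * real (length (nodes Nq)) - 1)"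
  using assms(1,2,4-)
proof (induction "length (nodes Nq) + weight R" arbitrary: Nq R st m w rule: less_induct)
  case less
  let ?\<beta> = "1 + 3 * B"
  let ?E = "\<lambda>Nq m w. real (min (nat (m - bottom_scale smin Nq)) w + scale_gaps smin W Nq)
        + 2 * real (length (nodes Nq)) - 1"
  have \<beta>: "0 \<le> ?\<beta>" using B_ge_1 by simp
  show ?case
  proof (cases "node_scale Nq < max_scale R")
    case True
    obtain p s cs where s: "Node p s cs \<in> set R" "max_scale R = ereal (of_int s)"
      using True by (rule less_max_scaleE)
    have Nq_scale: "node_scale Nq \<le> ereal (of_int (s - 1))" using True s(2) by (cases Nq) auto
    have "s \<le> m" using represents_Node(1) less.prems(3) s(1) by blast
    \<comment> \<open>No element of \<open>R\<close> has a scale above \<open>s\<close>, so the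
      levels between \<open>m\<close> and \<open>s\<close> are skipped at no cost.\<close>
    have rep: "\<forall>N\<in>set R. represents s N"
      using represents_lower[OF _ _ \<open>s \<le> m\<close>] less.prems(3) max_scale_ge[of _ R] s(2) by auto
    have "node_scale Nq \<le> ereal (of_int s)" using True s(2) by simp
    note adm = less.prems(5) this rep less.prems(4)
    have lengths: "real (length R) \<le> B" "real (length (ref_children R)) \<le> B"
      using length_R_le[OF adm] length_ref_children_le[OF adm s(2)] by auto
    define st1 where "st1 = fold (\<lambda>Nr st. snd (base (point Nq) (point Nr) st)) R st"
    define st2 where "st2 = snd (unpruned (kde_score K \<epsilon>) Nq (ref_children R) st1)"
    define R' where "R' = filter (kept Nq) (ref_children R)"
    have "weight R' < weight R"
      using weight_ref_children[OF True] weight_unpruned[of "kde_score K \<epsilon>" Nq "ref_children R" st1]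
      by (simp add: R'_def unpruned_eq)
    then have "real (snd (traverse base (kde_score K \<epsilon>) Nq R' st2)) \<le> ?\<beta> * ?E Nq (s - 1) (w - 1)"
    proof (intro less.hyps)
      show "set R' \<subseteq> set (nodes Tr)"
        using nodes_ref_children[OF less.prems(2)] by (auto simp: R'_def)
      show "\<forall>N\<in>set R'. represents (s - 1) N"
        using represents_ref_children[OF rep less.prems(4) s(2)] by (auto simp: R'_def)
      show "distinct (map point R')"
        using distinct_ref_children[OF rep less.prems(4) s(2)]
        by (auto simp: R'_def distinct_map intro: inj_on_subset)
      show "admissible Nq R'" by (auto simp: admissible_def R'_def)
    qed (use less.prems Nq_scale in auto)
    moreover have "real (snd (traverse base (kde_score K \<epsilon>) Nq R st)) =
        1 + 2 * real (length R) + real (length (ref_children R))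
        + real (snd (traverse base (kde_score K \<epsilon>) Nq R' st2))"
      using True by (subst traverse.simps)
        (simp add: Let_def st1_def[symmetric] st2_def[symmetric] unpruned_eq R'_def)
    \<comment> \<open>Both arguments of the minimum drop by at least 1; as the bottom scale lies
      below \<open>s\<close> and \<open>w\<close> is positive, truncation at 0 does not hide
      this.\<close>
    moreover have "?E Nq (s - 1) (w - 1) + 1 \<le> ?E Nq m w"
    proof -
      have "bottom_scale smin Nq < s"
        using Nq_scale assms(3)[of p s cs] s(1) less.prems(2) by (cases Nq) auto
      moreover have "1 \<le> w" using \<open>weight R' < weight R\<close> less.prems(7) by linarith
      ultimately show ?thesis using \<open>s \<le> m\<close> by simp
    qed
    then have "?\<beta> * (?E Nq (s - 1) (w - 1) + 1) \<le> ?\<beta> * ?E Nq m w"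
      using \<beta> by (rule mult_left_mono)
    then have "?\<beta> * ?E Nq (s - 1) (w - 1) + (1 + 3 * B) \<le> ?\<beta> * ?E Nq m w"
      by (simp only: distrib_left mult_1_right)
    ultimately show ?thesis using lengths by argo
  next
    case False
    define g where "g c st = traverse base (kde_score K \<epsilon>) c
      (fst (unpruned (kde_score K \<epsilon>) c R st)) (snd (unpruned (kde_score K \<epsilon>) c R st))" for c st
    have steps: "snd (traverse base (kde_score K \<epsilon>) Nq R st) =
        snd (fold (\<lambda>c (st, n). (fst (g c st), n + length R + snd (g c st))) (children Nq) (st, 1 + length R))"
      using False by (subst traverse.simps) (simp add: Let_def g_def)
    show ?thesis
    proof (cases Nq)
      case (Leaf p)
      \<comment> \<open>Here both nodes are leaves, so \<open>d_min\<close> and \<open>d_max\<close>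
        coincide and the gap is 0. Only a single unscored node can be left in
        \<open>R\<close>.\<close>
      have "\<not> kept Nq N" if "N \<in> set R" for N
        using max_scale_ge[OF that] False Leaf \<epsilon>
        by (cases N) (auto simp: kept_def d_min_def d_max_def)
      then have "length R \<le> 1" using less.prems(5) by (cases R) (auto simp: admissible_def)
      then have "real (snd (traverse base (kde_score K \<epsilon>) Nq R st)) \<le> ?\<beta> * 1"
        using steps Leaf B_ge_1 by simp
      also have "\<dots> \<le> ?\<beta> * ?E Nq m w"
        using \<beta> Leaf by (intro mult_left_mono) auto
      finally show ?thesis .
    next
      case (Node p k cs)
      have rep: "\<forall>N\<in>set R. represents k N"
      proof
        fix N assume N: "N \<in> set R"
        then show "represents k N"
          using represents_lower[of m N k] less.prems(3,6) max_scale_ge[OF N] False Node by auto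
      qed
      have R_le: "real (length R) \<le> B"
        by (rule length_R_le[OF less.prems(5) _ rep less.prems(4)]) (use Node in auto)
      have child: "real (length R + snd (g c st)) \<le> ?\<beta> * (?E c k W + 1)" if c: "c \<in> set cs" for c st
      proof -
        have "real (snd (g c st)) \<le> ?\<beta> * ?E c k W"
          unfolding g_def unpruned_eq
        proof (rule less.hyps)
          have w: "weight (filter (kept c) R) \<le> weight R"
            using weight_unpruned[of "kde_score K \<epsilon>" c R st] by (simp add: unpruned_eq)
          moreover have "length (nodes c) < length (nodes Nq)"
            using length_nodes_child[of c Nq] c Node by simp
          ultimately show "length (nodes c) + weight (filter (kept c) R) < length (nodes Nq) + weight R"
            by simp
          show "weight (filter (kept c) R) \<le> W" using w less.prems(7,8) by simp
          show "node_scale N < node_scale P" if "P \<in> set (nodes c)" "N \<in> set (children P)" for P N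
            using less.prems(1)[of P N] that c Node by auto
          show "node_scale c \<le> ereal (of_int k)"
            using less.prems(1)[of Nq c] c Node by simp
          show "distinct (map point (filter (kept c) R))"
            using less.prems(4) by (auto simp: distinct_map intro: inj_on_subset)
        qed (use less.prems(2) rep in \<open>auto simp: admissible_def\<close>)
        then show ?thesis using R_le B_ge_1 by (simp only: distrib_left of_nat_add mult_1_right)
      qed
      have "real (snd (traverse base (kde_score K \<epsilon>) Nq R st))
          \<le> real (1 + length R) + (\<Sum>c\<leftarrow>cs. ?\<beta> * (?E c k W + 1))"
        unfolding steps using child Node by (simp only: ctree.sel) (rule fold_steps_le)
      also have "\<dots> \<le> ?\<beta> + (\<Sum>c\<leftarrow>cs. ?\<beta> * (?E c k W + 1))"
        using R_le B_ge_1 by simp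
      also have "(\<Sum>c\<leftarrow>cs. ?\<beta> * (?E c k W + 1)) = ?\<beta> * (\<Sum>c\<leftarrow>cs. ?E c k W + 1)"
        by (simp add: sum_list_const_mult)
      also have "(\<Sum>c\<leftarrow>cs. ?E c k W + 1) = real (scale_gaps smin W Nq) + 2 * (real (length (nodes Nq)) - 1)"
      proof -
        have "(\<Sum>c\<leftarrow>cs. ?E c k W + 1) =
            real (\<Sum>c\<leftarrow>cs. min (nat (k - bottom_scale smin c)) W + scale_gaps smin W c)
            + 2 * real (weight cs)"
          by (induction cs) simp_all
        then show ?thesis using length_nodes[of Nq] Node by (simp add: scale_gaps_Node)
      qed
      also have "?\<beta> + ?\<beta> * (real (scale_gaps smin W Nq) + 2 * (real (length (nodes Nq)) - 1))
          = ?\<beta> * (real (scale_gaps smin W Nq) + 2 * real (length (nodes Nq)) - 1)"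
        by (simp add: algebra_simps)
      also have "\<dots> \<le> ?\<beta> * ?E Nq m w"
        using \<beta> by (intro mult_left_mono) auto
      finally show ?thesis .
    qed
  qed
qed

end

section \<open>Scales and imbalance\<close>

lemma finite_scales: "finite {s. \<exists>p cs. Node p s cs \<in> set (nodes T)}"
proof (rule finite_subset)
  show "{s. \<exists>p cs. Node p s cs \<in> set (nodes T)} \<subseteq> level ` set (nodes T)" by force
qed simp

lemma min_scale_le:
  assumes "Node p s cs \<in> set (nodes T)"
  shows "min_scale T \<le> s"
  using assms finite_scales[of T] by (auto simp: min_scale_def intro!: Min_le)

lemma min_scale_attained:
  assumes "Node p s cs \<in> set (nodes T)"
  obtains p' cs' where "Node p' (min_scale T) cs' \<in> set (nodes T)"
proof -
  have "min_scale T \<in> {s. \<exists>p cs. Node p s cs \<in> set (nodes T)}"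
    unfolding min_scale_def using assms finite_scales by (intro Min_in) auto
  then show ?thesis using that by auto
qed

lemma finite_distances: "finite S \<Longrightarrow> finite {dist x y | x y. x \<in> S \<and> y \<in> S \<and> x \<noteq> y}"
  by (rule finite_subset[of _ "(\<lambda>(x, y). dist x y) ` (S \<times> S)"]) auto

lemma sum_length_children: "(\<Sum>P\<leftarrow>nodes T. length (children P)) + 1 = length (nodes T)"
proof (induction T)
  case (Node p s cs)
  then have "(\<Sum>P\<leftarrow>concat (map nodes cs). length (children P)) + length cs
      = (\<Sum>c\<leftarrow>cs. length (nodes c))"
    by (induction cs) force+
  then show ?case by (simp add: length_concat comp_def)
qed simp

text \<open>The comparison is made edge by edge, and there are fewer edges than nodes to pay
  \<open>e\<close> for.\<close>

lemma scale_gaps_le_tree_imbalance: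
  assumes "\<And>P N. \<lbrakk>P \<in> set (nodes T); N \<in> set (children P)\<rbrakk> \<Longrightarrow>
      real (min (nat (level P - bottom_scale smin N)) W)
        \<le> real_of_int (node_imbalance (min_scale T) (level P) N) + e"
    and "0 \<le> e"
  shows "real (scale_gaps smin W T) \<le> real_of_int (tree_imbalance T) + e * real (length (nodes T))"
proof -
  have of_nat: "real (\<Sum>x\<leftarrow>xs. f x) = (\<Sum>x\<leftarrow>xs. real (f x))" for f :: "'b ctree \<Rightarrow> nat" and xs
    by (induction xs) auto
  have of_int: "real_of_int (\<Sum>x\<leftarrow>xs. f x) = (\<Sum>x\<leftarrow>xs. real_of_int (f x))"
    for f :: "'b ctree \<Rightarrow> int" and xs
    by (induction xs) auto
  have "real (scale_gaps smin W T) \<le> (\<Sum>P\<leftarrow>nodes T. \<Sum>N\<leftarrow>children P.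
      real_of_int (node_imbalance (min_scale T) (level P) N) + e)"
    unfolding scale_gaps_def of_nat by (intro sum_list_mono assms(1))
  also have "\<dots> = real_of_int (tree_imbalance T) + (\<Sum>P\<leftarrow>nodes T. e * real (length (children P)))"
    by (simp add: tree_imbalance_def of_int sum_list_addf sum_list_triv mult.commute)
  also have "(\<Sum>P\<leftarrow>nodes T. e * real (length (children P)))
      = e * real (\<Sum>P\<leftarrow>nodes T. length (children P))"
    by (simp add: of_nat sum_list_const_mult)
  also have "\<dots> \<le> e * real (length (nodes T))"
    using sum_length_children[of T] assms(2) by (intro mult_left_mono) auto
  finally show ?thesis by simp
qed

section \<open>Imbalance, smallest scale and smallest distance\<close>

context implicit_tree
begin

lemma node_scale_child_less:
  assumes "represents s T" "P \<in> set (nodes T)" "N \<in> set (children P)"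
  shows "node_scale N < node_scale P"
proof -
  obtain p k cs where P: "P = Node p k cs" using assms(3) by (cases P) auto
  obtain t where "represents t P" using represents_nodes[OF assms(1,2)] .
  then have "represents (k - 1) N" using represents_Node(6) assms(3) unfolding P by simp
  then show ?thesis using represents_scale[of "k - 1" N] P by (cases N) auto
qed

lemma node_imbalance_nonneg:
  assumes "represents s T" "P \<in> set (nodes T)" "N \<in> set (children P)"
  shows "0 \<le> node_imbalance smin (level P) N"
  using node_scale_child_less[OF assms] assms(3) by (cases P; cases N) auto

lemma tree_imbalance_nonneg:
  assumes "represents s T"
  shows "0 \<le> tree_imbalance T"
  unfolding tree_imbalance_def
  by (auto intro!: sum_list_nonneg node_imbalance_nonneg[OF assms])

text \<open>A non-self child lies within the covering distance. At the smallest scale, this and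
  \<open>less_min_dist\<close> enclose the smallest distance between consecutive powers of
  2.\<close>

lemma min_dist_less:
  assumes "represents s T" "finite S" "Node p k cs \<in> set (nodes T)"
  shows "min_dist S < 2 powi k"
proof -
  obtain t where t: "represents t (Node p k cs)" using represents_nodes[OF assms(1,3)] .
  then obtain q where q: "q \<in> kids C par k p" "q \<noteq> p" by (rule represents_two_children)
  have "p \<in> S" "q \<in> S"
    using represents_Node(2)[OF t] q(1) subset by (auto simp: kids_def)
  then have "min_dist S \<le> dist q p"
    unfolding min_dist_def using q(2) finite_distances[OF assms(2)] by (intro Min_le) auto
  also have "dist q p < 2 powi k" using q(1) par_dist[of q "k - 1"] by (auto simp: kids_def)
  finally show ?thesis .
qed

lemma less_min_dist:
  assumes "represents s T" "C s = {point T}" "finite S" "Node p k cs \<in> set (nodes T)"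
  shows "2 powi (min_scale T - 1) < min_dist S"
proof -
  obtain t where t: "represents t (Node p k cs)" using represents_nodes[OF assms(1,4)] .
  then obtain q where q: "q \<in> kids C par k p" "q \<noteq> p" by (rule represents_two_children)
  have pq: "p \<in> S" "q \<in> S"
    using represents_Node(2)[OF t] q(1) subset by (auto simp: kids_def)
  have "T \<noteq> Leaf p'" for p' using assms(4) by auto
  then obtain p' k' cs' where T: "T = Node p' k' cs'" by (cases T) auto
  have "S \<subseteq> C (min_scale T - 1)"
  proof -
    have "min_scale T \<le> k'" using T by (intro min_scale_le[of p' _ cs']) auto
    then have "min_scale T - 1 \<le> s" using represents_Node(1) assms(1) unfolding T by fastforce
    from leaf_points_level[OF assms(1) this min_scale_le] show ?thesis
      by (simp add: leaf_points_root[OF assms(1,2)])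
  qed
  then show ?thesis
    unfolding min_dist_def using q(2) pq finite_distances[OF assms(3)] separated
    by (subst Min_gr_iff) blast+
qed

lemma card_ge_2:
  assumes "represents s T" "finite S" "Node p k cs \<in> set (nodes T)"
  shows "2 \<le> card S"
proof -
  obtain t where t: "represents t (Node p k cs)" using represents_nodes[OF assms(1,3)] .
  then obtain q where q: "q \<in> kids C par k p" "q \<noteq> p" by (rule represents_two_children)
  have "{p, q} \<subseteq> S" using represents_Node(2)[OF t] q(1) subset by (auto simp: kids_def)
  then have "card {p, q} \<le> card S" using assms(2) by (rule card_mono[rotated])
  then show ?thesis using q(2) by simp
qed

text \<open>Above \<open>s\<close> there is only the root, so its self-chain extends upwards. This
  provides a common starting level above the roots of both trees.\<close>

lemma represents_raise:
  assumes "represents s T" "C s = {point T}" "s \<le> t"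
  shows "represents t T"
proof -
  have C: "C u = {point T}" if "s \<le> u" for u
  proof -
    have "C u \<subseteq> {point T}" using nested[OF that] assms(2) by simp
    moreover have "r \<in> C u" using implicit_axioms[THEN conjunct1] by blast
    ultimately show ?thesis by blast
  qed
  have kids: "kids C par u (point T) = {point T}" if "s < u" for u
    using C[of "u - 1"] C[of u] self_in_kids[of "point T" u] that by (auto simp: kids_def)
  have "coalesced C par s (point T) T" using assms(1) by (simp add: represents_def)
  then have "coalesced C par t (point T) T"
  proof (cases rule: coalesced.cases)
    case coalesced_leaf
    have "coalesced C par t (point T) (Leaf (point T))"
      using coalesced_leaf(2) kids by (intro coalesced.coalesced_leaf) (metis not_le)
    then show ?thesis using coalesced_leaf(1) by metis
  next
    case (coalesced_node k cs)
    have "coalesced C par t (point T) (Node (point T) k cs)"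
    proof (rule coalesced.coalesced_node)
      show "kids C par u (point T) = {point T}" if "k < u" for u
        using coalesced_node(3) kids that by (metis not_le)
    qed (use coalesced_node assms(3) in auto)
    then show ?thesis using coalesced_node(1) by metis
  qed
  then show ?thesis using C[OF assms(3)] by (simp add: represents_def)
qed

lemma root_Node:
  assumes "represents s T" "C s = {point T}" "2 \<le> card S"
  obtains p k cs where "T = Node p k cs"
  using leaf_points_root[OF assms(1,2)] assms(3) by (cases T) auto

end

lemma cover_treeE:
  assumes "cover_tree S T"
  obtains r C par s where "finite S" "implicit_tree S r C par"
    "implicit_tree.represents C par s T" "C s = {point T}"
proof -
  obtain r C par s where *: "implicit_cover_tree S r C par" "C s = {r}" "coalesced C par s r T"
    using assms by (auto simp: cover_tree_def)
  interpret implicit_tree S r C par using *(1) by unfold_locales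
  have "point T = r" using *(3) by (cases rule: coalesced.cases) auto
  then show ?thesis
    using that[of r C par s] * assms implicit_tree_axioms by (auto simp: represents_def cover_tree_def)
qed

lemma theta_nonneg: "0 \<le> theta Sq Sr"
  by (simp add: theta_def)

text \<open>The imbalance measures the leaves of the query tree down to the smallest query scale; \<open>e\<close>
  pays for the reference recursions at the scales below.\<close>

lemma scale_gap_le_imbalance:
  assumes "cover_tree Sq Tq" "cover_tree Sr Tr"
  obtains e where "0 \<le> e" "real (card Sr) * e \<le> 3 * real (card Sr) + 2 * theta Sq Sr"
    "\<And>P N. \<lbrakk>P \<in> set (nodes Tq); N \<in> set (children P)\<rbrakk> \<Longrightarrow>
      real (min (nat (level P - bottom_scale (min_scale Tr) N)) (length (nodes Tr)))
        \<le> real_of_int (node_imbalance (min_scale Tq) (level P) N) + e"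
proof -
  obtain rq Cq parq sq where q: "finite Sq" "implicit_tree Sq rq Cq parq"
    "implicit_tree.represents Cq parq sq Tq" "Cq sq = {point Tq}"
    using assms(1) by (rule cover_treeE)
  obtain rr Cr parr sr where r: "finite Sr" "implicit_tree Sr rr Cr parr"
    "implicit_tree.represents Cr parr sr Tr" "Cr sr = {point Tr}"
    using assms(2) by (rule cover_treeE)
  interpret Q: implicit_tree Sq rq Cq parq by (rule q)
  interpret R: implicit_tree Sr rr Cr parr by (rule r)
  have W: "real (length (nodes Tr)) + 1 \<le> 2 * real (card Sr)"
    using R.length_nodes_le[OF r(3,1)] by linarith
  show ?thesis
  proof (cases "card Sq < 2 \<or> card Sr < 2")
    \<comment> \<open>A query node with a child forces two query points. So it is the reference set
      that is small, and its tree has at most one node.\<close>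
    case True
    show ?thesis
    proof (rule that)
      show "real (card Sr) * 3 \<le> 3 * real (card Sr) + 2 * theta Sq Sr"
        using theta_nonneg[of Sq Sr] by simp
      fix P N assume N: "P \<in> set (nodes Tq)" "N \<in> set (children P)"
      obtain p k cs where "P = Node p k cs" using N(2) by (cases P) auto
      then have "2 \<le> card Sq" using Q.card_ge_2[OF q(3,1)] N(1) by simp
      then have "real (length (nodes Tr)) \<le> 1" using True W by linarith
      then show "real (min (nat (level P - bottom_scale (min_scale Tr) N)) (length (nodes Tr)))
        \<le> real_of_int (node_imbalance (min_scale Tq) (level P) N) + 3"
        using Q.node_imbalance_nonneg[OF q(3) N, of "min_scale Tq"] by simp
    qed simp
  next
    case False
    define L where "L = log 2 (min_dist Sq / min_dist Sr)"
    obtain pq kq csq where Tq: "Tq = Node pq kq csq" using Q.root_Node[OF q(3,4)] False by force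
    obtain pr kr csr where Tr: "Tr = Node pr kr csr" using R.root_Node[OF r(3,4)] False by force
    obtain p cs where p: "Node p (min_scale Tr) cs \<in> set (nodes Tr)"
      using min_scale_attained[of pr kr csr Tr] Tr by auto
    have dq: "2 powi (min_scale Tq - 1) < min_dist Sq"
      using Q.less_min_dist[OF q(3,4,1), of pq kq csq] Tq by simp
    have dr: "min_dist Sr < 2 powi min_scale Tr" using R.min_dist_less[OF r(3,1) p] .
    have dq0: "0 < min_dist Sq" using dq by (rule less_trans[rotated]) simp
    have dr0: "0 < min_dist Sr"
      using R.less_min_dist[OF r(3,4,1) p] by (rule less_trans[rotated]) simp
    \<comment> \<open>The added 1 comes from \<open>min_dist Sq\<close> being bounded from below
      only at one scale under \<open>min_scale Tq\<close>.\<close>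
    have L: "real_of_int (min_scale Tq - min_scale Tr) \<le> L + 1"
    proof -
      have "2 powi (min_scale Tq - 1) / 2 powi min_scale Tr \<le> min_dist Sq / min_dist Sr"
        using dq dq0 dr dr0 by (intro frac_le) auto
      moreover have "(2::real) powi (min_scale Tq - 1) / 2 powi min_scale Tr
          = 2 powr real_of_int (min_scale Tq - 1 - min_scale Tr)"
        by (subst powr_real_of_int') (simp_all add: power_int_diff)
      ultimately have "2 powr real_of_int (min_scale Tq - 1 - min_scale Tr)
          \<le> min_dist Sq / min_dist Sr" by simp
      then have "real_of_int (min_scale Tq - 1 - min_scale Tr) \<le> L"
        unfolding L_def by (subst le_log_iff) (use dq0 dr0 in auto)
      then show ?thesis by simp
    qed
    show ?thesis
    proof (rule that)
      \<comment> \<open>At a leaf the gap extends to one below the smallest reference scale, while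
        the imbalance stops one above the smallest query scale: an offset of 2, and \<open>L\<close>
        costs another 1. The size of the reference tree enters through the cap on the gap.\<close>
      let ?e = "3 + min (max L 0) (real (length (nodes Tr)))" and ?n = "real (card Sr)"
      show "0 \<le> ?e" by simp
      \<comment> \<open>The reference tree may have nearly \<open>2 * ?n\<close> nodes, whereas
        \<open>theta\<close> contains only \<open>?n\<close> squared; this is the origin of the
        factor 2 before \<open>theta\<close>.\<close>
      have min_max_le: "min (max x 0) (2 * y) \<le> 2 * max (min x y) 0" if "0 \<le> y" for x y :: real
        using that by (auto simp: min_def max_def)
      have "?n * ?e \<le> ?n * (3 + min (max L 0) (2 * ?n))"
        using W by (intro mult_left_mono) auto
      also have "\<dots> = 3 * ?n + min (max (?n * L) 0) (2 * ?n\<^sup>2)"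
        by (simp add: algebra_simps min_mult_distrib_left max_mult_distrib_left power2_eq_square)
      also have "\<dots> \<le> 3 * ?n + 2 * max (min (?n * L) (?n\<^sup>2)) 0"
        using min_max_le[of "?n\<^sup>2" "?n * L"] by simp
      also have "max (min (?n * L) (?n\<^sup>2)) 0 = theta Sq Sr"
        using False by (simp add: theta_def L_def)
      finally show "?n * ?e \<le> 3 * ?n + 2 * theta Sq Sr" .
      fix P N assume N: "P \<in> set (nodes Tq)" "N \<in> set (children P)"
      show "real (min (nat (level P - bottom_scale (min_scale Tr) N)) (length (nodes Tr)))
        \<le> real_of_int (node_imbalance (min_scale Tq) (level P) N) + ?e"
      proof (cases N)
        case (Leaf p)
        then show ?thesis using L by (simp add: min_def max_def) linarith
      next
        case (Node p k cs)
        have "k < level P" using Node Q.node_scale_child_less[OF q(3) N] N(2) by (cases P) auto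
        have "real (min (nat (level P - bottom_scale (min_scale Tr) N)) (length (nodes Tr)))
            \<le> real (nat (level P - k))" using Node by simp
        also have "\<dots> = real_of_int (level P - k)" using \<open>k < level P\<close> by simp
        also have "\<dots> \<le> real_of_int (node_imbalance (min_scale Tq) (level P) N) + 3"
          using Node by simp
        also have "\<dots> \<le> real_of_int (node_imbalance (min_scale Tq) (level P) N) + ?e" by simp
        finally show ?thesis .
      qed
    qed
  qed
qed

theorem theorem3:
  fixes A :: real
  shows "\<exists>M>0. \<forall>(Sq :: 'a::real_normed_vector set) (Sr :: 'a set) Tq Tr (K :: real \<Rightarrow> real) K' h \<epsilon>.
    (\<forall>d\<ge>0. 0 \<le> K d) \<longrightarrow>
    antimono_on {0..} K \<longrightarrow>
    0 \<le> h \<longrightarrow> concave_on {0..h} K \<longrightarrow> convex_on {h..} K \<longrightarrow>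
    (K has_real_derivative K') (at h within {0..}) \<longrightarrow>
    0 < \<epsilon> \<longrightarrow> (\<exists>!d. 0 \<le> d \<and> K d = \<epsilon>) \<longrightarrow>
    cover_tree Sr Tr \<longrightarrow> cover_tree Sq Tq \<longrightarrow>
    real (card Sq) \<le> A * real (card Sr) \<longrightarrow>
    real (kde_running_time K \<epsilon> Tq Tr)
      \<le> M * expansion_constant Sr ^ (8 + nat \<lceil>log 2 (zeta K K' \<epsilon>)\<rceil>)
          * (real (card Sr) + real_of_int (tree_imbalance Tq) + theta Sq Sr)"
\<comment> \<open>The traversal contributes
  \<open>8 * ?n + 4 * ?i + 40 * (A * ?n) + 16 * (A * ?\<theta>)\<close> and the extraction
  \<open>2 * (A * ?n)\<close>, each times \<open>B\<close>. The absolute value keeps the witness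
  positive for every \<open>A\<close>.\<close>
proof (intro exI[of _ "8 + 42 * \<bar>A\<bar>"] conjI allI impI)
  fix Sq Sr :: "'a set" and Tq Tr :: "'a ctree" and K :: "real \<Rightarrow> real" and K' h \<epsilon> :: real
  assume "\<forall>d\<ge>0. 0 \<le> K d" "antimono_on {0..} K" "0 \<le> h" "concave_on {0..h} K"
    "convex_on {h..} K" "(K has_real_derivative K') (at h within {0..})" "0 < \<epsilon>"
    "\<exists>!d. 0 \<le> d \<and> K d = \<epsilon>"
  then interpret kde_kernel K K' h \<epsilon> by unfold_locales auto
  assume trees: "cover_tree Sr Tr" "cover_tree Sq Tq" and card: "real (card Sq) \<le> A * real (card Sr)"
  obtain rq Cq parq sq where q: "finite Sq" "implicit_tree Sq rq Cq parq"
    "implicit_tree.represents Cq parq sq Tq" "Cq sq = {point Tq}"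
    using trees(2) by (rule cover_treeE)
  obtain rr Cr parr sr where r: "finite Sr" "implicit_tree Sr rr Cr parr"
    "implicit_tree.represents Cr parr sr Tr" "Cr sr = {point Tr}"
    using trees(1) by (rule cover_treeE)
  interpret Q: implicit_tree Sq rq Cq parq by (rule q)
  interpret R: implicit_tree Sr rr Cr parr by (rule r)
  interpret kde_traversal Sr rr Cr parr K K' h \<epsilon> by unfold_locales (rule r)
  obtain e where e: "0 \<le> e" "real (card Sr) * e \<le> 3 * real (card Sr) + 2 * theta Sq Sr"
    "\<And>P N. \<lbrakk>P \<in> set (nodes Tq); N \<in> set (children P)\<rbrakk> \<Longrightarrow>
      real (min (nat (level P - bottom_scale (min_scale Tr) N)) (length (nodes Tr)))
        \<le> real_of_int (node_imbalance (min_scale Tq) (level P) N) + e"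
    using scale_gap_le_imbalance[OF trees(2,1)] by blast
  let ?n = "real (card Sr)" and ?i = "real_of_int (tree_imbalance Tq)" and ?\<theta> = "theta Sq Sr"
  have Tq: "real (length (nodes Tq)) \<le> 2 * (A * ?n)"
    using Q.length_nodes_le[OF q(3,1)] card by linarith
  have Tr: "real (length (nodes Tr)) \<le> 2 * ?n"
    using R.length_nodes_le[OF r(3,1)] by linarith
  have i: "0 \<le> ?i" using Q.tree_imbalance_nonneg[OF q(3)] by simp
  \<comment> \<open>The node bound forces \<open>Sq\<close> to be nonempty, which rules out a
    negative \<open>A\<close>.\<close>
  have "0 < real (card Sq)" using Q.length_nodes_le[OF q(3,1)] by linarith
  then have A: "0 \<le> A" using card by (smt (verit) mult_nonpos_nonneg of_nat_0_le_iff)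
  define gaps where "gaps = scale_gaps (min_scale Tr) (length (nodes Tr)) Tq"
  have "real gaps \<le> ?i + e * real (length (nodes Tq))"
    unfolding gaps_def using e(3,1) by (rule scale_gaps_le_tree_imbalance)
  also have "e * real (length (nodes Tq)) \<le> e * (2 * (A * ?n))"
    using Tq e(1) by (rule mult_left_mono)
  also have "\<dots> = 2 * A * (?n * e)" by simp
  also have "\<dots> \<le> 2 * A * (3 * ?n + 2 * ?\<theta>)" using e(2) A by (intro mult_left_mono) auto
  finally have gaps: "real gaps \<le> ?i + 2 * A * (3 * ?n + 2 * ?\<theta>)" by simp
  define m where "m = max sq sr"
  have m: "node_scale Tq \<le> ereal (of_int m)" "R.represents m Tr"
  proof -
    have "node_scale Tq \<le> ereal (of_int sq)" using Q.represents_scale q(3) .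
    also have "\<dots> \<le> ereal (of_int m)" by (simp add: m_def)
    finally show "node_scale Tq \<le> ereal (of_int m)" .
    show "R.represents m Tr" using R.represents_raise[OF r(3,4)] by (simp add: m_def)
  qed
  let ?steps = "snd (traverse (kde_base K) (kde_score K \<epsilon>) Tq [Tr] ((\<lambda>_. 0), (\<lambda>_. 0)))"
  have "real ?steps \<le> (1 + 3 * B) * (real (min (nat (m - bottom_scale (min_scale Tr) Tq))
      (length (nodes Tr)) + gaps) + 2 * real (length (nodes Tq)) - 1)"
    unfolding gaps_def
  proof (rule traverse_steps_le)
    show "node_scale N < node_scale P" if "P \<in> set (nodes Tq)" "N \<in> set (children P)" for P N
      using Q.node_scale_child_less[OF q(3) that] .
    show "min_scale Tr \<le> s" if "Node p s cs \<in> set (nodes Tr)" for p s cs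
      using min_scale_le[OF that] .
  qed (use m in \<open>auto simp: admissible_def\<close>)
  \<comment> \<open>The minimum at the root is bounded by its cap, the size of the reference tree,
    and \<open>1 + 3 * B\<close> by \<open>4 * B\<close>.\<close>
  also have "\<dots> \<le> (4 * B) * (2 * ?n + (?i + 2 * A * (3 * ?n + 2 * ?\<theta>)) + 4 * (A * ?n))"
    using gaps Tr Tq B_ge_1 sum_length_children[of Tq] by (intro mult_mono) auto
  finally have steps: "real ?steps \<le> B * (8 * ?n + 4 * ?i + 40 * (A * ?n) + 16 * (A * ?\<theta>))"
    by (simp add: algebra_simps)
  have "real (kde_running_time K \<epsilon> Tq Tr) = real ?steps + real (length (nodes Tq))"
    by (simp add: kde_running_time_def approx_kde_def split_beta)
  also have "real (length (nodes Tq)) \<le> B * (2 * (A * ?n))"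
    using Tq A B_ge_1 mult_right_mono[of 1 B "2 * (A * ?n)"] by simp
  also note steps
  also have "B * (8 * ?n + 4 * ?i + 40 * (A * ?n) + 16 * (A * ?\<theta>)) + B * (2 * (A * ?n))
      \<le> B * ((8 + 42 * A) * (?n + ?i + ?\<theta>))"
  proof -
    have "0 \<le> A * ?i" "0 \<le> A * ?\<theta>" using A i theta_nonneg[of Sq Sr] by auto
    then have "8 * ?n + 4 * ?i + 40 * (A * ?n) + 16 * (A * ?\<theta>) + 2 * (A * ?n)
        \<le> (8 + 42 * A) * (?n + ?i + ?\<theta>)"
      using i theta_nonneg[of Sq Sr] by (simp add: algebra_simps)
    then show ?thesis using B_ge_1 by (simp flip: distrib_left)
  qed
  finally show "real (kde_running_time K \<epsilon> Tq Tr)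
    \<le> (8 + 42 * \<bar>A\<bar>) * expansion_constant Sr ^ (8 + nat \<lceil>log 2 (zeta K K' \<epsilon>)\<rceil>) * (?n + ?i + ?\<theta>)"
    using A by (simp add: B_def mult_ac)
qed simp

end
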